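(* Let $\Omega$ be a simply connected compact set in the complex plane, let $F:\Omega\to\mathbb{C}$ be an arbitrary function, and let $N\ge 0$ be an integer. Suppose that there exists a finite sequence of polynomials $\{Q_n\}_{n=0,1,\dots,N}$, where $Q_n$ has degree at most $n$, which satisfies $$\lVert F-Q_n\rVert_{L^\infty(\Omega)}\le C_N\rho^{-n},\qquad 0\le n\le N,$$ for some constants $\rho>1$ and $C_N\ge 0$. Let $P_N(z)=\sum_{k=0}^N a_kz^k$ be the $N$th degree interpolating polynomial of $F$ for a given set of distinct interpolation points $Z=\{z_j\}_{j=0,1,\dots,N}\subset\Omega$ (that is, the polynomial of degree at most $N$ with $P_N(z_j)=F(z_j)$ for $j=0,\dots,N$). Then the 2-norm of the monomial coefficient vector $a^{(N)}:=(a_0,a_1,\dots,a_N)^T$ of $P_N$ satisfies $$\lVert a^{(N)}\rVert_2\le\lVert F\rVert_{L^\infty(\Omega)}+C_N\Bigl(\Lambda_N\Bigl(\frac{\rho_*}{\rho}\Bigr)^N+2\rho_*\sum_{j=0}^{N-1}\Bigl(\frac{\rho_*}{\rho}\Bigr)^j+1\Bigr),$$ where $\rho_*$ is the parameter of $\Omega$ defined in the context and $\Lambda_N$ denotes the Lebesgue constant for $Z$ over $\Omega$.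
   Context: $\lVert\cdot\rVert_2$ is the Euclidean norm and $\lVert g\rVert_{L^\infty(\Omega)}=\sup_{z\in\Omega}|g(z)|$. Lebesgue constant: for distinct points $Z=\{z_j\}_{j=0}^N\subset\Omega$, $$\Lambda_N:=\sup_{G\in C(\Omega),\,G\ne 0}\frac{\lVert P_N[G]\rVert_{L^\infty(\Omega)}}{\lVert G\rVert_{L^\infty(\Omega)}},$$ where $P_N[G]$ is the polynomial of degree at most $N$ interpolating $G$ at the points of $Z$. Level sets: for a simply connected compact set $\Omega\subset\mathbb{C}$ (identified with a subset of $\mathbb{R}^2$) and $\rho>1$, let $E_\rho:=\{x+iy\in\mathbb{C}:G(x,y)=\log\rho\}$, where $G:\mathbb{R}^2\to\mathbb{R}$ is the unique solution of the exterior Laplace problem $$\nabla^2G=0\ \text{in }\mathbb{R}^2\setminus\Omega,\qquad G=0\ \text{on }\partial\Omega,\qquad G(x,y)\sim\log r\ \text{as }r:=\sqrt{x^2+y^2}\to\infty.$$ It is understood that $\Omega$ consists of more than one point, so that $G$ exists. Let $E_\rho^o$ denote the bounded open region with boundary $E_\rho$ (i.e. $\Omega\cup\{x+iy\notin\Omega:G(x,y)<\log\rho\}$). The parameter $\rho_*$: $\rho_*:=\inf\{\rho>1:D_1\subset E_\rho^o\}$, where $D_1$ is the open unit disk centered at the origin. *)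

theory Defs
  imports "HOL-Analysis.Analysis" "HOL-Computational_Algebra.Polynomial"
begin

text \<open>The value is taken in \<^typ>\<open>ennreal\<close>, so that it is a genuine supremum
  (namely \<open>\<infinity>\<close>) also for functions that are unbounded on \<open>\<Omega>\<close>.\<close>

definition sup_norm :: "complex set \<Rightarrow> (complex \<Rightarrow> complex) \<Rightarrow> ennreal" where
  "sup_norm \<Omega> g = (SUP z\<in>\<Omega>. ennreal (cmod (g z)))"

definition interpolates :: "nat \<Rightarrow> (nat \<Rightarrow> complex) \<Rightarrow> (complex \<Rightarrow> complex) \<Rightarrow> complex poly \<Rightarrow> bool" where
  "interpolates N z g p \<longleftrightarrow> degree p \<le> N \<and> (\<forall>j\<le>N. poly p (z j) = g (z j))"

definition interp_poly :: "nat \<Rightarrow> (nat \<Rightarrow> complex) \<Rightarrow> (complex \<Rightarrow> complex) \<Rightarrow> complex poly" where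
  "interp_poly N z g = (THE p. interpolates N z g p)"

definition lebesgue_constant :: "complex set \<Rightarrow> nat \<Rightarrow> (nat \<Rightarrow> complex) \<Rightarrow> ennreal" where
  "lebesgue_constant \<Omega> N z =
     (SUP g \<in> {g. continuous_on \<Omega> g \<and> (\<exists>x\<in>\<Omega>. g x \<noteq> 0)}.
        sup_norm \<Omega> (poly (interp_poly N z g)) / sup_norm \<Omega> g)"

text \<open>Harmonic functions on an open subset \<open>S\<close> of the plane: twice continuously differentiable
  in the real sense, with vanishing Laplacian. Here \<open>ux\<close>, \<open>uy\<close> are the first and \<open>uxx\<close>, \<open>uxy\<close>,
  \<open>uyx\<close>, \<open>uyy\<close> the second partial derivatives with respect to \<open>x = Re z\<close> and \<open>y = Im z\<close>.\<close>

definition harmonic_on :: "complex set \<Rightarrow> (complex \<Rightarrow> real) \<Rightarrow> bool" where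
  "harmonic_on S u \<longleftrightarrow>
     (\<exists>ux uy uxx uxy uyx uyy.
        (\<forall>z\<in>S.
           (u has_derivative (\<lambda>h. ux z * Re h + uy z * Im h)) (at z) \<and>
           (ux has_derivative (\<lambda>h. uxx z * Re h + uxy z * Im h)) (at z) \<and>
           (uy has_derivative (\<lambda>h. uyx z * Re h + uyy z * Im h)) (at z) \<and>
           uxx z + uyy z = 0) \<and>
        continuous_on S uxx \<and> continuous_on S uxy \<and>
        continuous_on S uyx \<and> continuous_on S uyy)"

text \<open>The exterior Laplace problem. The boundary condition is understood classically, i.e. the
  solution is continuous up to the boundary; note that \<open>- interior \<Omega>\<close> is the closure of
  \<open>- \<Omega>\<close>. The condition \<open>G \<sim> log r\<close> means that the quotient tends to 1.\<close>

definition exterior_laplace_solution :: "complex set \<Rightarrow> (complex \<Rightarrow> real) \<Rightarrow> bool" where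
  "exterior_laplace_solution \<Omega> G \<longleftrightarrow>
     harmonic_on (- \<Omega>) G \<and>
     continuous_on (- interior \<Omega>) G \<and>
     (\<forall>z\<in>frontier \<Omega>. G z = 0) \<and>
     ((\<lambda>z. G z / ln (cmod z)) \<longlongrightarrow> 1) at_infinity"

text \<open>The problem determines the solution only on \<open>- interior \<Omega>\<close>, hence the use of \<open>SOME\<close>
  instead of \<open>THE\<close>; the values in the interior of \<open>\<Omega>\<close> are not used below.\<close>

definition green_function :: "complex set \<Rightarrow> complex \<Rightarrow> real" where
  "green_function \<Omega> = (SOME G. exterior_laplace_solution \<Omega> G)"

text \<open>The region \<open>E\<^sub>\<rho>\<^sup>o\<close> enclosed by the level curve on which the Green function is \<open>log \<rho>\<close>.\<close>

definition level_region :: "complex set \<Rightarrow> real \<Rightarrow> complex set" where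
  "level_region \<Omega> \<rho> = \<Omega> \<union> {z. z \<notin> \<Omega> \<and> green_function \<Omega> z < ln \<rho>}"

definition rho_star :: "complex set \<Rightarrow> real" where
  "rho_star \<Omega> = Inf {\<rho>. \<rho> > 1 \<and> ball 0 1 \<subseteq> level_region \<Omega> \<rho>}"

end

theory Submission
  imports Defs "HOL-Complex_Analysis.Complex_Analysis"
begin

text \<open>Write \<open>P = Q\<^sub>0 + (\<Sum>j<N. Q\<^sub>j\<^sub>+\<^sub>1 - Q\<^sub>j) + (P - Q\<^sub>N)\<close>. Each summand is small on \<open>\<Omega>\<close>: the last one is the
  interpolant of \<open>F - Q\<^sub>N\<close> and is controlled by the Lebesgue constant. The Bernstein--Walsh
  inequality \<open>|p| \<le> M exp (n G)\<close> for a polynomial of degree at most \<open>n\<close> that is bounded by \<open>M\<close> on \<open>\<Omega>\<close>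
  transfers these bounds to the unit disk, where Parseval's identity turns them into bounds for
  the coefficients. Bernstein--Walsh is the maximum principle for \<open>log |p| - c G\<close> and holds
  for every solution of the exterior Laplace problem, so no uniqueness is needed. Existence of a
  solution comes from the Riemann mapping theorem: an inversion about a point of \<open>\<Omega>\<close> maps the
  outer domain together with \<open>\<infinity>\<close> onto a simply connected domain, and \<open>G\<close> is minus the
  logarithm of the modulus of its Riemann map.\<close>

subsection \<open>Harmonic functions\<close>

text \<open>If \<open>l\<close> were positive, then \<open>f'\<close>, which vanishes at
  \<open>0\<close>, would be positive just to the right of \<open>0\<close>, and the mean value
  theorem would give \<open>f t > f 0\<close> there.\<close>

lemma second_deriv_nonpos_at_local_max:
  fixes f f' :: "real \<Rightarrow> real"
  assumes "d > 0"
    and f: "\<And>t. \<bar>t\<bar> < d \<Longrightarrow> (f has_real_derivative f' t) (at t)"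
    and f': "(f' has_real_derivative l) (at 0)"
    and max: "\<And>t. \<bar>t\<bar> < d \<Longrightarrow> f t \<le> f 0"
  shows "l \<le> 0"
proof (rule ccontr)
  assume "\<not> l \<le> 0"
  have "f' 0 = 0"
    using DERIV_local_max[of f "f' 0" 0 d] f[of 0] max \<open>d > 0\<close> by auto
  obtain e where e: "e > 0" "\<And>h. 0 < h \<Longrightarrow> h < e \<Longrightarrow> f' 0 < f' (0 + h)"
    using DERIV_pos_inc_right[OF f'] \<open>\<not> l \<le> 0\<close> by auto
  define t where "t = min d e / 2"
  have t: "0 < t" "t < d" "t < e"
    using \<open>d > 0\<close> \<open>e > 0\<close> by (auto simp: t_def min_def)
  obtain s where s: "0 < s" "s < t" "f t - f 0 = (t - 0) * f' s"
    using MVT2[of 0 t f f'] f t by auto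
  have "f' s > 0"
    using e(2)[of s] s t \<open>f' 0 = 0\<close> by auto
  then have "f t - f 0 > 0"
    unfolding s(3) using t by simp
  then show False
    using max[of t] t by auto
qed

lemma harmonic_onI:
  assumes "\<And>z. z \<in> S \<Longrightarrow> (u has_derivative (\<lambda>h. ux z * Re h + uy z * Im h)) (at z)"
    and "\<And>z. z \<in> S \<Longrightarrow> (ux has_derivative (\<lambda>h. uxx z * Re h + uxy z * Im h)) (at z)"
    and "\<And>z. z \<in> S \<Longrightarrow> (uy has_derivative (\<lambda>h. uyx z * Re h + uyy z * Im h)) (at z)"
    and "\<And>z. z \<in> S \<Longrightarrow> uxx z + uyy z = 0"
    and "continuous_on S uxx" "continuous_on S uxy" "continuous_on S uyx" "continuous_on S uyy"
  shows "harmonic_on S u"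
  unfolding harmonic_on_def
  by (rule exI[of _ ux], rule exI[of _ uy], rule exI[of _ uxx], rule exI[of _ uxy],
      rule exI[of _ uyx], rule exI[of _ uyy]) (simp add: assms)

lemma harmonic_onE:
  assumes "harmonic_on S u"
  obtains ux uy uxx uxy uyx uyy where
    "\<forall>z\<in>S. (u has_derivative (\<lambda>h. ux z * Re h + uy z * Im h)) (at z)"
    "\<forall>z\<in>S. (ux has_derivative (\<lambda>h. uxx z * Re h + uxy z * Im h)) (at z)"
    "\<forall>z\<in>S. (uy has_derivative (\<lambda>h. uyx z * Re h + uyy z * Im h)) (at z)"
    "\<forall>z\<in>S. uxx z + uyy z = 0"
    "continuous_on S uxx" "continuous_on S uxy" "continuous_on S uyx" "continuous_on S uyy"
proof -
  from assms obtain ux uy uxx uxy uyx uyy where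
    "\<forall>z\<in>S. (u has_derivative (\<lambda>h. ux z * Re h + uy z * Im h)) (at z) \<and>
           (ux has_derivative (\<lambda>h. uxx z * Re h + uxy z * Im h)) (at z) \<and>
           (uy has_derivative (\<lambda>h. uyx z * Re h + uyy z * Im h)) (at z) \<and>
           uxx z + uyy z = 0"
    "continuous_on S uxx" "continuous_on S uxy" "continuous_on S uyx" "continuous_on S uyy"
    unfolding harmonic_on_def by (elim exE conjE) (rule that)
  then show thesis
    by (intro that[of ux uy uxx uxy uyx uyy]) auto
qed

lemma harmonic_on_subset:
  assumes "harmonic_on S u" "T \<subseteq> S"
  shows "harmonic_on T u"
proof -
  obtain ux uy uxx uxy uyx uyy where u:
      "\<forall>z\<in>S. (u has_derivative (\<lambda>h. ux z * Re h + uy z * Im h)) (at z)"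
      "\<forall>z\<in>S. (ux has_derivative (\<lambda>h. uxx z * Re h + uxy z * Im h)) (at z)"
      "\<forall>z\<in>S. (uy has_derivative (\<lambda>h. uyx z * Re h + uyy z * Im h)) (at z)"
      "\<forall>z\<in>S. uxx z + uyy z = 0"
      "continuous_on S uxx" "continuous_on S uxy" "continuous_on S uyx" "continuous_on S uyy"
    by (rule harmonic_onE[OF assms(1)])
  show ?thesis
    by (rule harmonic_onI[of T u ux uy uxx uxy uyx uyy])
      (use u \<open>T \<subseteq> S\<close> in \<open>auto intro: continuous_on_subset\<close>)
qed

lemma harmonic_on_diff_cmult:
  assumes "harmonic_on S u" "harmonic_on S v"
  shows "harmonic_on S (\<lambda>z. u z - c * v z)"
proof -
  obtain ux uy uxx uxy uyx uyy where u:
      "\<forall>z\<in>S. (u has_derivative (\<lambda>h. ux z * Re h + uy z * Im h)) (at z)"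
      "\<forall>z\<in>S. (ux has_derivative (\<lambda>h. uxx z * Re h + uxy z * Im h)) (at z)"
      "\<forall>z\<in>S. (uy has_derivative (\<lambda>h. uyx z * Re h + uyy z * Im h)) (at z)"
      "\<forall>z\<in>S. uxx z + uyy z = 0"
      "continuous_on S uxx" "continuous_on S uxy" "continuous_on S uyx" "continuous_on S uyy"
    by (rule harmonic_onE[OF assms(1)])
  note u = u[rule_format]
  obtain vx vy vxx vxy vyx vyy where v:
      "\<forall>z\<in>S. (v has_derivative (\<lambda>h. vx z * Re h + vy z * Im h)) (at z)"
      "\<forall>z\<in>S. (vx has_derivative (\<lambda>h. vxx z * Re h + vxy z * Im h)) (at z)"
      "\<forall>z\<in>S. (vy has_derivative (\<lambda>h. vyx z * Re h + vyy z * Im h)) (at z)"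
      "\<forall>z\<in>S. vxx z + vyy z = 0"
      "continuous_on S vxx" "continuous_on S vxy" "continuous_on S vyx" "continuous_on S vyy"
    by (rule harmonic_onE[OF assms(2)])
  note v = v[rule_format]
  have lin: "((\<lambda>z. f z - c * g z) has_derivative (\<lambda>h. (a - c * a') * Re h + (b - c * b') * Im h)) (at z)"
    if "(f has_derivative (\<lambda>h. a * Re h + b * Im h)) (at z)"
       "(g has_derivative (\<lambda>h. a' * Re h + b' * Im h)) (at z)" for f g a b a' b' z
    using has_derivative_diff[OF that(1) has_derivative_mult_right[OF that(2), of c]]
    by (simp add: algebra_simps)
  have trace: "uxx z - c * vxx z + (uyy z - c * vyy z) = 0" if "z \<in> S" for z
  proof -
    have "uyy z = - uxx z" "vyy z = - vxx z"
      using u(4) v(4) that by (simp_all add: eq_neg_iff_add_eq_0 add.commute)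
    then show ?thesis by simp
  qed
  show ?thesis
    by (rule harmonic_onI[of S _ "\<lambda>z. ux z - c * vx z" "\<lambda>z. uy z - c * vy z"
          "\<lambda>z. uxx z - c * vxx z" "\<lambda>z. uxy z - c * vxy z"
          "\<lambda>z. uyx z - c * vyx z" "\<lambda>z. uyy z - c * vyy z"])
      (use u v in \<open>auto intro!: lin trace continuous_intros\<close>)
qed

text \<open>Here \<open>g = ux - \<i> uy\<close>. The Cauchy--Riemann equations give
  \<open>uxx = Re g'\<close> and \<open>uyy = - Re g'\<close>, so the Laplacian vanishes. This form
  covers \<open>ln |f|\<close> even where \<open>f\<close> has no single-valued logarithm.\<close>

lemma harmonic_on_complex_gradient:
  assumes "open S" and g: "g holomorphic_on S"
    and u: "\<And>z. z \<in> S \<Longrightarrow> (u has_derivative (\<lambda>h. Re (g z * h))) (at z)"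
  shows "harmonic_on S u"
proof -
  have g': "(g has_derivative (\<lambda>h. deriv g z * h)) (at z)" if "z \<in> S" for z
    using holomorphic_derivI[OF g \<open>open S\<close> that] by (simp add: has_field_derivative_def)
  have c: "continuous_on S (deriv g)"
    by (intro holomorphic_on_imp_continuous_on holomorphic_deriv assms)
  have 1: "((\<lambda>z. Re (g z)) has_derivative (\<lambda>h. Re (deriv g z) * Re h + - Im (deriv g z) * Im h)) (at z)"
    if "z \<in> S" for z
    using has_derivative_Re[OF g'[OF that]] by simp
  have 2: "((\<lambda>z. - Im (g z)) has_derivative (\<lambda>h. - Im (deriv g z) * Re h + - Re (deriv g z) * Im h)) (at z)"
    if "z \<in> S" for z
    using has_derivative_minus[OF has_derivative_Im[OF g'[OF that]]] by (simp add: algebra_simps)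
  show ?thesis
    by (rule harmonic_onI[OF _ 1 2]) (use u in \<open>auto intro!: continuous_intros c\<close>)
qed

text \<open>The gradient is given by the logarithmic derivative \<open>f' / f\<close>. It is
  obtained by differentiating the norm, so no branch of the logarithm has to be chosen.\<close>

lemma has_derivative_ln_cmod:
  assumes "(f has_field_derivative f') (at z)" "f z \<noteq> 0"
  shows "((\<lambda>z. ln (cmod (f z))) has_derivative (\<lambda>h. Re (f' / f z * h))) (at z)"
proof -
  have f: "(f has_derivative (\<lambda>h. f' * h)) (at z)"
    using assms by (simp add: has_field_derivative_def)
  have n: "(norm has_derivative (\<lambda>h. inner h (sgn (f z)))) (at (f z))"
    by (rule has_derivative_norm[OF assms(2)])
  have "((\<lambda>z. ln (cmod (f z))) has_derivative (\<lambda>h. (f' * h) \<bullet> sgn (f z) * inverse (cmod (f z)))) (at z)"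
    using has_derivative_ln[OF _ has_derivative_compose[OF f n]] assms by simp
  also have "(\<lambda>h. (f' * h) \<bullet> sgn (f z) * inverse (cmod (f z))) = (\<lambda>h. Re (f' / f z * h))"
  proof
    fix h
    have "Re (f' / f z * h) = Re ((f' * h) * cnj (f z)) / (cmod (f z))\<^sup>2"
      by (metis Re_divide_of_real complex_div_cnj times_divide_eq_left of_real_power)
    also have "\<dots> = (f' * h) \<bullet> f z / (cmod (f z))\<^sup>2"
      by (simp add: inner_complex_def)
    also have "\<dots> = (f' * h) \<bullet> sgn (f z) * inverse (cmod (f z))"
      by (simp add: sgn_div_norm power2_eq_square divide_inverse mult_ac)
    finally show "(f' * h) \<bullet> sgn (f z) * inverse (cmod (f z)) = Re (f' / f z * h)" ..
  qed
  finally show ?thesis .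
qed

lemma harmonic_on_ln_cmod:
  assumes "open S" "f holomorphic_on S" "\<And>z. z \<in> S \<Longrightarrow> f z \<noteq> 0"
  shows "harmonic_on S (\<lambda>z. ln (cmod (f z)))"
proof (rule harmonic_on_complex_gradient)
  show "(\<lambda>z. deriv f z / f z) holomorphic_on S"
    using assms by (intro holomorphic_intros) auto
  show "((\<lambda>z. ln (cmod (f z))) has_derivative (\<lambda>h. Re (deriv f z / f z * h))) (at z)" if "z \<in> S" for z
    using assms that by (intro has_derivative_ln_cmod holomorphic_derivI) auto
qed fact

text \<open>The Laplacian of \<open>\<delta> |z|\<^sup>2\<close> is \<open>4 \<delta> > 0\<close>, so one of the two pure second derivatives is
  positive.\<close>

lemma harmonic_on_plus_square_no_local_max:
  assumes u: "harmonic_on S u" and "r > 0" "ball z r \<subseteq> S" "\<delta> > 0"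
  shows "\<exists>w\<in>ball z r. u w + \<delta> * (cmod w)\<^sup>2 > u z + \<delta> * (cmod z)\<^sup>2"
proof (rule ccontr)
  assume "\<not> ?thesis"
  then have max: "u w + \<delta> * (cmod w)\<^sup>2 \<le> u z + \<delta> * (cmod z)\<^sup>2" if "w \<in> ball z r" for w
    using that by force
  obtain ux uy uxx uxy uyx uyy where u:
      "\<forall>z\<in>S. (u has_derivative (\<lambda>h. ux z * Re h + uy z * Im h)) (at z)"
      "\<forall>z\<in>S. (ux has_derivative (\<lambda>h. uxx z * Re h + uxy z * Im h)) (at z)"
      "\<forall>z\<in>S. (uy has_derivative (\<lambda>h. uyx z * Re h + uyy z * Im h)) (at z)"
      "\<forall>z\<in>S. uxx z + uyy z = 0"
    by (rule harmonic_onE[OF u])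
  note u = u[rule_format]
  have "z \<in> S" using assms by auto
  \<comment> \<open>Restricting to the line through \<open>z\<close> in a unit direction
    \<open>e\<close> leaves one real variable; \<open>e = 1\<close> and \<open>e = \<i>\<close> give
    the two pure second derivatives.\<close>
  have line: "((\<lambda>t. z + of_real t * e) has_derivative (\<lambda>s. of_real s * e)) (at t)" for e :: complex and t
    by (auto intro!: derivative_eq_intros)
  have inb: "z + of_real t * e \<in> ball z r" if "\<bar>t\<bar> < r" "cmod e = 1" for t e
    using that by (simp add: dist_norm norm_mult)
  have D1: "((\<lambda>t. u (z + of_real t * e)) has_derivative
       (\<lambda>s. ux (z + of_real t * e) * Re (of_real s * e) + uy (z + of_real t * e) * Im (of_real s * e))) (at t)"
    if "\<bar>t\<bar> < r" "cmod e = 1" for e t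
    by (rule has_derivative_compose[OF line u(1)]) (use inb[OF that] assms in auto)
  have D2: "((\<lambda>t. ux (z + of_real t * e)) has_derivative
       (\<lambda>s. uxx z * Re (of_real s * e) + uxy z * Im (of_real s * e))) (at 0)" for e
    by (rule has_derivative_compose[OF line]) (use u(2) \<open>z \<in> S\<close> in simp)
  have D3: "((\<lambda>t. uy (z + of_real t * e)) has_derivative
       (\<lambda>s. uyx z * Re (of_real s * e) + uyy z * Im (of_real s * e))) (at 0)" for e
    by (rule has_derivative_compose[OF line]) (use u(3) \<open>z \<in> S\<close> in simp)
  have x: "uxx z + 2 * \<delta> \<le> 0"
  proof (rule second_deriv_nonpos_at_local_max[OF \<open>r > 0\<close>,
        where f = "\<lambda>t. u (z + of_real t * 1) + \<delta> * ((Re z + t)\<^sup>2 + (Im z)\<^sup>2)"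
          and f' = "\<lambda>t. ux (z + of_real t * 1) + 2 * \<delta> * (Re z + t)"])
    show "((\<lambda>t. u (z + of_real t * 1) + \<delta> * ((Re z + t)\<^sup>2 + (Im z)\<^sup>2)) has_real_derivative
         ux (z + of_real t * 1) + 2 * \<delta> * (Re z + t)) (at t)" if "\<bar>t\<bar> < r" for t
      using D1[OF that, of 1] unfolding has_field_derivative_def
      by (auto intro!: derivative_eq_intros simp: algebra_simps)
    show "((\<lambda>t. ux (z + of_real t * 1) + 2 * \<delta> * (Re z + t)) has_real_derivative uxx z + 2 * \<delta>) (at 0)"
      using D2[of 1] unfolding has_field_derivative_def
      by (auto intro!: derivative_eq_intros simp: algebra_simps)
    show "u (z + of_real t * 1) + \<delta> * ((Re z + t)\<^sup>2 + (Im z)\<^sup>2) \<le>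
        u (z + of_real 0 * 1) + \<delta> * ((Re z + 0)\<^sup>2 + (Im z)\<^sup>2)" if "\<bar>t\<bar> < r" for t
      using max[OF inb[OF that, of 1]] by (simp add: cmod_power2)
  qed
  have y: "uyy z + 2 * \<delta> \<le> 0"
  proof (rule second_deriv_nonpos_at_local_max[OF \<open>r > 0\<close>,
        where f = "\<lambda>t. u (z + of_real t * \<i>) + \<delta> * ((Re z)\<^sup>2 + (Im z + t)\<^sup>2)"
          and f' = "\<lambda>t. uy (z + of_real t * \<i>) + 2 * \<delta> * (Im z + t)"])
    show "((\<lambda>t. u (z + of_real t * \<i>) + \<delta> * ((Re z)\<^sup>2 + (Im z + t)\<^sup>2)) has_real_derivative
         uy (z + of_real t * \<i>) + 2 * \<delta> * (Im z + t)) (at t)" if "\<bar>t\<bar> < r" for t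
      using D1[OF that, of \<i>] unfolding has_field_derivative_def
      by (auto intro!: derivative_eq_intros simp: algebra_simps)
    show "((\<lambda>t. uy (z + of_real t * \<i>) + 2 * \<delta> * (Im z + t)) has_real_derivative uyy z + 2 * \<delta>) (at 0)"
      using D3[of \<i>] unfolding has_field_derivative_def
      by (auto intro!: derivative_eq_intros simp: algebra_simps)
    show "u (z + of_real t * \<i>) + \<delta> * ((Re z)\<^sup>2 + (Im z + t)\<^sup>2) \<le>
        u (z + of_real 0 * \<i>) + \<delta> * ((Re z)\<^sup>2 + (Im z + 0)\<^sup>2)" if "\<bar>t\<bar> < r" for t
      using max[OF inb[OF that, of \<i>]] by (simp add: cmod_power2)
  qed
  show False
    using x y u(4)[OF \<open>z \<in> S\<close>] \<open>\<delta> > 0\<close> by linarith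
qed

subsection \<open>The Bernstein--Walsh inequality\<close>

lemma poly_growth:
  fixes p :: "complex poly"
  assumes "degree p \<le> n" "cmod w \<ge> 1"
  shows "cmod (poly p w) \<le> (\<Sum>i\<le>degree p. cmod (coeff p i)) * cmod w ^ n"
proof -
  have "cmod (poly p w) \<le> (\<Sum>i\<le>degree p. cmod (coeff p i) * cmod w ^ i)"
    unfolding poly_altdef by (rule order_trans[OF norm_sum]) (simp add: norm_mult norm_power)
  also have "\<dots> \<le> (\<Sum>i\<le>degree p. cmod (coeff p i) * cmod w ^ n)"
    using assms by (intro sum_mono mult_left_mono power_increasing) auto
  finally show ?thesis
    by (simp add: sum_distrib_right)
qed

text \<open>Since \<open>G\<close> is only known up to \<open>o(log r)\<close> at infinity, the exponent \<open>c\<close> has to be strictly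
  larger than \<open>n\<close>; the bound for \<open>c = n\<close> is recovered as a limit.\<close>

lemma exterior_laplace_solution_weight_tendsto_0:
  assumes G: "exterior_laplace_solution \<Omega> G" and "degree p \<le> n" and "c > real n"
  shows "((\<lambda>w. cmod (poly p w) * exp (- c * G w)) \<longlongrightarrow> 0) at_infinity"
proof -
  define K where "K = (\<Sum>i\<le>degree p. cmod (coeff p i))"
  \<comment> \<open>Half of the excess \<open>c - n\<close> is spent on replacing \<open>G\<close>
    by the smaller \<open>\<theta> ln |w|\<close> with \<open>\<theta> < 1\<close>. The other half,
    \<open>\<eta>\<close>, remains as decay: the weight is at most
    \<open>K |w| powr - \<eta>\<close> near infinity.\<close>
  define \<eta> where "\<eta> = (c - n) / 2"
  define \<theta> where "\<theta> = (n + \<eta>) / c"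
  have c: "c > 0" "\<eta> > 0" "c * \<theta> = n + \<eta>" "\<theta> < 1"
    using \<open>c > real n\<close> by (auto simp: \<eta>_def \<theta>_def field_simps)
  have K: "K \<ge> 0" by (simp add: K_def sum_nonneg)
  have "((\<lambda>w::complex. K * cmod w powr - \<eta>) \<longlongrightarrow> K * 0) at_infinity"
    using c by (intro tendsto_intros tendsto_neg_powr filterlim_norm_at_top) simp
  then have lim: "((\<lambda>w::complex. K * cmod w powr - \<eta>) \<longlongrightarrow> 0) at_infinity"
    by simp
  have "((\<lambda>z. G z / ln (cmod z)) \<longlongrightarrow> 1) at_infinity"
    using G by (simp add: exterior_laplace_solution_def)
  then have "eventually (\<lambda>w. G w / ln (cmod w) > \<theta>) at_infinity"
    using c by (simp add: order_tendstoD)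
  moreover have "eventually (\<lambda>w::complex. cmod w > 1) at_infinity"
    using filterlim_norm_at_top[where 'a = complex] by (auto simp: filterlim_at_top_dense)
  ultimately have "eventually (\<lambda>w. norm (cmod (poly p w) * exp (- c * G w)) \<le> K * cmod w powr - \<eta>) at_infinity"
  proof eventually_elim
    case (elim w)
    have "ln (cmod w) > 0" using elim by (intro ln_gt_zero)
    then have "\<theta> * ln (cmod w) \<le> G w"
      using elim by (simp add: field_simps)
    then have "c * (\<theta> * ln (cmod w)) \<le> c * G w"
      using c by (intro mult_left_mono) auto
    then have "c * \<theta> * ln (cmod w) \<le> c * G w"
      by (simp only: mult.assoc)
    then have "exp (- c * G w) \<le> exp (- n * ln (cmod w)) * exp (- \<eta> * ln (cmod w))"
      unfolding c exp_add[symmetric] by (simp add: algebra_simps)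
    also have "exp (- n * ln (cmod w)) = inverse (cmod w ^ n)"
    proof -
      have "exp (real n * ln (cmod w)) = cmod w ^ n"
        using elim by (subst exp_of_nat_mult, subst exp_ln) auto
      then show ?thesis
        by (simp add: exp_minus)
    qed
    also have "exp (- \<eta> * ln (cmod w)) = cmod w powr - \<eta>"
      using elim by (auto simp: powr_def)
    finally have "cmod (poly p w) * exp (- c * G w) \<le> (K * cmod w ^ n) * (inverse (cmod w ^ n) * cmod w powr - \<eta>)"
      using poly_growth[OF assms(2), of w] elim K by (intro mult_mono) (auto simp: K_def)
    also have "\<dots> = K * cmod w powr - \<eta>"
      using elim by (auto simp: field_simps)
    finally show ?case by (simp add: norm_mult)
  qed
  then show ?thesis
    by (rule Lim_null_comparison[OF _ lim])
qed

text \<open>Maximum principle for \<open>v = |p| exp (- c G)\<close>: it is at most \<open>M\<close>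
  on the frontier, where \<open>G = 0\<close>, and tends to \<open>0\<close> at infinity, so a value
  above \<open>M\<close> would force a maximum at an interior point. The factor
  \<open>exp (\<delta> |w|^2)\<close> excludes such a point. Working with \<open>v\<close> instead
  of its logarithm keeps the zeros of \<open>p\<close> in the domain.\<close>

lemma Bernstein_Walsh_aux:
  assumes "compact \<Omega>" and "\<Omega> \<noteq> {}" and G: "exterior_laplace_solution \<Omega> G"
    and p: "\<And>w. w \<in> \<Omega> \<Longrightarrow> cmod (poly p w) \<le> M" and "degree p \<le> n"
    and "z \<notin> \<Omega>" and "c > real n"
  shows "cmod (poly p z) * exp (- c * G z) \<le> M"
proof (rule ccontr)
  define v where "v = (\<lambda>w. cmod (poly p w) * exp (- c * G w))"
  define m where "m = v z"
  assume "\<not> ?thesis"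
  then have "m > M" by (simp add: m_def v_def)
  obtain x where "x \<in> \<Omega>" using \<open>\<Omega> \<noteq> {}\<close> by auto
  then have "M \<ge> 0" using p[of x] norm_ge_zero order_trans by blast
  with \<open>m > M\<close> have "m > 0" by simp
  have G_props: "harmonic_on (- \<Omega>) G" "continuous_on (- interior \<Omega>) G" "\<And>z. z \<in> frontier \<Omega> \<Longrightarrow> G z = 0"
    using G by (auto simp: exterior_laplace_solution_def)
  have "closed \<Omega>" using \<open>compact \<Omega>\<close> by (rule compact_imp_closed)
  have "eventually (\<lambda>w. v w < m / 2) at_infinity"
    using exterior_laplace_solution_weight_tendsto_0[OF G \<open>degree p \<le> n\<close> \<open>c > n\<close>] \<open>m > 0\<close>
    unfolding v_def by (intro order_tendstoD) auto
  then obtain R0 where R0: "\<And>w. cmod w \<ge> R0 \<Longrightarrow> v w < m / 2"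
    by (auto simp: eventually_at_infinity)
  define R where "R = max R0 (cmod z + 1)"
  have R: "\<And>w. cmod w \<ge> R \<Longrightarrow> v w < m / 2" "cmod z < R"
    using R0 by (auto simp: R_def)
  \<comment> \<open>\<open>\<delta>\<close> is chosen so small that the extra factor cannot undo the
    boundary estimates: on \<open>cball 0 R\<close> it stays below \<open>2\<close>, against
    \<open>v < m / 2\<close> on the circle, and \<open>M\<close> times it stays below
    \<open>m\<close>.\<close>
  have "((\<lambda>\<delta>::real. exp (\<delta> * R\<^sup>2)) \<longlongrightarrow> exp (0 * R\<^sup>2)) (at_right 0)"
    by (intro tendsto_intros)
  then have "eventually (\<lambda>\<delta>::real. exp (\<delta> * R\<^sup>2) < 2) (at_right 0)"
    by (rule order_tendstoD) simp
  moreover have "((\<lambda>\<delta>::real. M * exp (\<delta> * R\<^sup>2)) \<longlongrightarrow> M * exp (0 * R\<^sup>2)) (at_right 0)"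
    by (intro tendsto_intros)
  then have "eventually (\<lambda>\<delta>::real. M * exp (\<delta> * R\<^sup>2) < m) (at_right 0)"
    by (rule order_tendstoD) (use \<open>m > M\<close> in simp)
  moreover have "eventually (\<lambda>\<delta>::real. \<delta> > 0) (at_right 0)"
    by (rule eventually_at_right_less)
  ultimately have "eventually (\<lambda>\<delta>::real. exp (\<delta> * R\<^sup>2) < 2 \<and> M * exp (\<delta> * R\<^sup>2) < m \<and> \<delta> > 0) (at_right 0)"
    by eventually_elim auto
  then obtain \<delta> :: real where \<delta>: "exp (\<delta> * R\<^sup>2) < 2" "M * exp (\<delta> * R\<^sup>2) < m" "\<delta> > 0"
    using eventually_happens' trivial_limit_at_right_real by blast
  \<comment> \<open>The closure of the complement of \<Omega>, cut off at radius \<open>R\<close>: a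
    compact set on which the weighted function attains its maximum.\<close>
  define T where "T = (- interior \<Omega>) \<inter> cball 0 R"
  have "compact T"
    unfolding T_def by (intro closed_Int_compact) auto
  have "z \<in> T"
    using \<open>z \<notin> \<Omega>\<close> R(2) interior_subset by (auto simp: T_def)
  have cont: "continuous_on T (\<lambda>w. v w * exp (\<delta> * (cmod w)\<^sup>2))"
    unfolding v_def by (intro continuous_intros continuous_on_subset[OF G_props(2)]) (auto simp: T_def)
  then obtain z1 where z1: "z1 \<in> T"
    "\<And>w. w \<in> T \<Longrightarrow> v w * exp (\<delta> * (cmod w)\<^sup>2) \<le> v z1 * exp (\<delta> * (cmod z1)\<^sup>2)"
    using continuous_attains_sup[OF \<open>compact T\<close> _ cont] \<open>z \<in> T\<close> by blast
  have "m \<le> v z * exp (\<delta> * (cmod z)\<^sup>2)"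
    using mult_left_mono[of 1 "exp (\<delta> * (cmod z)\<^sup>2)" "v z"] \<delta> by (simp add: m_def v_def)
  then have big: "m \<le> v z1 * exp (\<delta> * (cmod z1)\<^sup>2)"
    using z1(2)[OF \<open>z \<in> T\<close>] by simp
  have le: "exp (\<delta> * (cmod z1)\<^sup>2) \<le> exp (\<delta> * R\<^sup>2)"
    using z1(1) \<delta> by (auto simp: T_def power_mono)
  have "z1 \<notin> \<Omega>"
  proof
    assume "z1 \<in> \<Omega>"
    then have "z1 \<in> frontier \<Omega>"
      using z1(1) \<open>closed \<Omega>\<close> by (auto simp: T_def frontier_def)
    then have "v z1 \<le> M"
      using G_props(3) p \<open>z1 \<in> \<Omega>\<close> by (simp add: v_def)
    then have "v z1 * exp (\<delta> * (cmod z1)\<^sup>2) \<le> M * exp (\<delta> * R\<^sup>2)"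
      using le \<open>M \<ge> 0\<close> by (intro mult_mono) auto
    then show False using big \<delta> by linarith
  qed
  have "cmod z1 < R"
  proof (rule ccontr)
    assume "\<not> cmod z1 < R"
    then have "v z1 < m / 2" using R(1) by simp
    then have "v z1 * exp (\<delta> * (cmod z1)\<^sup>2) < m / 2 * 2"
      using le_less_trans[OF le \<delta>(1)] \<open>m > 0\<close> by (intro mult_strict_mono) (auto simp: v_def)
    then show False using big by simp
  qed
  \<comment> \<open>At a zero of \<open>p\<close> the maximized function would be \<open>0\<close>,
    which is less than \<open>m\<close>; hence \<open>ln |p|\<close> is defined near
    \<open>z1\<close>.\<close>
  have "poly p z1 \<noteq> 0"
    using big \<open>m > 0\<close> by (auto simp: v_def)
  define S where "S = - \<Omega> \<inter> {w. poly p w \<noteq> 0} \<inter> ball 0 R"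
  have "open {w. poly p w \<noteq> 0}"
    by (intro open_Collect_neq continuous_intros)
  then have "open S"
    using \<open>closed \<Omega>\<close> unfolding S_def by (intro open_Int) auto
  have "z1 \<in> S"
    using \<open>z1 \<notin> \<Omega>\<close> \<open>cmod z1 < R\<close> \<open>poly p z1 \<noteq> 0\<close> by (simp add: S_def)
  then obtain r where r: "r > 0" "ball z1 r \<subseteq> S"
    using \<open>open S\<close> open_contains_ball by blast
  have "harmonic_on S (\<lambda>w. ln (cmod (poly p w)) - c * G w)"
  proof (intro harmonic_on_diff_cmult harmonic_on_ln_cmod)
    show "harmonic_on S G"
      using G_props(1) by (rule harmonic_on_subset) (auto simp: S_def)
  qed (use \<open>open S\<close> in \<open>auto simp: S_def intro!: holomorphic_intros\<close>)
  from harmonic_on_plus_square_no_local_max[OF this r \<open>\<delta> > 0\<close>] obtain w where w: "w \<in> ball z1 r"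
    "ln (cmod (poly p w)) - c * G w + \<delta> * (cmod w)\<^sup>2 > ln (cmod (poly p z1)) - c * G z1 + \<delta> * (cmod z1)\<^sup>2"
    by blast
  have ex: "exp (ln (cmod (poly p y)) - c * G y + \<delta> * (cmod y)\<^sup>2) = v y * exp (\<delta> * (cmod y)\<^sup>2)" if "y \<in> S" for y
    using that by (simp add: v_def exp_add exp_diff exp_minus divide_inverse S_def)
  have "w \<in> S" using w(1) r by auto
  then have "v z1 * exp (\<delta> * (cmod z1)\<^sup>2) < v w * exp (\<delta> * (cmod w)\<^sup>2)"
    using w(2) ex[OF \<open>z1 \<in> S\<close>] ex[of w] by (metis exp_less_cancel_iff)
  moreover have "w \<in> T"
    using \<open>w \<in> S\<close> interior_subset by (force simp: S_def T_def)
  ultimately show False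
    using z1(2) by force
qed

theorem Bernstein_Walsh:
  assumes "compact \<Omega>" and "\<Omega> \<noteq> {}" and "exterior_laplace_solution \<Omega> G"
    and "\<And>w. w \<in> \<Omega> \<Longrightarrow> cmod (poly p w) \<le> M" and "degree p \<le> n"
    and "z \<notin> \<Omega>"
  shows "cmod (poly p z) \<le> M * exp (real n * G z)"
proof (rule tendsto_lowerbound)
  show "((\<lambda>c. M * exp (c * G z)) \<longlongrightarrow> M * exp (real n * G z)) (at_right (real n))"
    by (intro tendsto_intros)
  show "eventually (\<lambda>c. cmod (poly p z) \<le> M * exp (c * G z)) (at_right (real n))"
    using eventually_at_right_less
  proof eventually_elim
    case (elim c)
    then show ?case
      using Bernstein_Walsh_aux[OF assms, of c] by (simp add: exp_minus field_simps)
  qed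
qed simp

subsection \<open>Existence of the Green function\<close>

text \<open>The inserted \<open>0\<close> is the image of the point at infinity.\<close>

definition inverted_outside :: "complex set \<Rightarrow> complex \<Rightarrow> complex set" where
  "inverted_outside \<Omega> a = insert 0 ((\<lambda>z. 1 / (z - a)) ` outside \<Omega>)"

text \<open>The inverse map \<open>a + 1 / w\<close> tests membership. At \<open>w = 0\<close> the
  convention \<open>1 / 0 = 0\<close> makes it return \<open>a\<close>, which is not in the outside,
  hence the separate disjunct.\<close>

lemma inverted_outside_iff:
  assumes "a \<in> \<Omega>"
  shows "w \<in> inverted_outside \<Omega> a \<longleftrightarrow> w = 0 \<or> a + 1 / w \<in> outside \<Omega>"
proof -
  have "a \<notin> outside \<Omega>" using assms outside_no_overlap by blast
  show ?thesis
  proof (cases "w = 0")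
    case False
    have "w \<in> (\<lambda>z. 1 / (z - a)) ` outside \<Omega>" if "a + 1 / w \<in> outside \<Omega>"
      using that False by (intro image_eqI[of _ _ "a + 1 / w"]) auto
    moreover have "a + 1 / (1 / (z - a)) = z" if "z \<in> outside \<Omega>" for z
      by simp
    ultimately show ?thesis
      using False by (auto simp: inverted_outside_def)
  qed (simp add: inverted_outside_def)
qed

section \<open>Topology of the inverted outer domain\<close>

lemma large_in_outside:
  fixes \<Omega> :: "complex set"
  assumes "bounded \<Omega>"
  obtains R where "R > 0" "\<And>z. cmod z > R \<Longrightarrow> z \<in> outside \<Omega>"
proof -
  obtain R where R: "R > 0" "\<Omega> \<subseteq> ball 0 R"
    using bounded_subset_ballD[OF assms] by blast
  have "- ball 0 R \<subseteq> outside \<Omega>"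
    using outside_subset_convex[OF convex_ball R(2)] .
  then show thesis
    by (intro that[of R]) (use R in auto)
qed

text \<open>Away from \<open>0\<close> the set is a preimage of the open outside under a continuous
  map. Around \<open>0\<close> it contains a disk, because \<open>a + 1 / w\<close> is large for
  small \<open>w\<close>.\<close>

lemma open_inverted_outside:
  assumes "compact \<Omega>" "a \<in> \<Omega>"
  shows "open (inverted_outside \<Omega> a)"
proof -
  have o: "open (outside \<Omega>)"
    using assms open_outside compact_imp_closed by blast
  obtain R where R: "R > 0" "\<And>z. cmod z > R \<Longrightarrow> z \<in> outside \<Omega>"
    using large_in_outside compact_imp_bounded assms by blast
  \<comment> \<open>For \<open>0 < |w| < r\<close> this gives \<open>|1 / w| > R + |a| + 1\<close>,
    and therefore \<open>|a + 1 / w| > R\<close>.\<close>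
  define r where "r = 1 / (R + cmod a + 1)"
  have pos: "R + cmod a + 1 > 0" using R(1) by (simp add: add_pos_nonneg)
  then have "r > 0" by (simp add: r_def)
  have ball: "ball 0 r \<subseteq> inverted_outside \<Omega> a"
  proof
    fix w :: complex assume w: "w \<in> ball 0 r"
    show "w \<in> inverted_outside \<Omega> a"
    proof (cases "w = 0")
      case False
      then have "R + cmod a + 1 < cmod (1 / w)"
        using w pos by (simp add: r_def norm_divide field_simps)
      also have "\<dots> \<le> cmod (a + 1 / w) + cmod a"
        using norm_triangle_ineq4[of "a + 1 / w" a] by simp
      finally show ?thesis
        using R(2) assms by (simp add: inverted_outside_iff)
    qed (simp add: inverted_outside_def)
  qed
  have "open {w \<in> - {0}. a + 1 / w \<in> outside \<Omega>}"
  proof -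
    have "continuous_on (- {0}) (\<lambda>w. a + 1 / w)"
      by (intro continuous_intros) auto
    from continuous_open_preimage[OF this open_Compl[OF closed_singleton] o] show ?thesis
      by (simp add: vimage_def Int_def)
  qed
  moreover have "inverted_outside \<Omega> a = {w \<in> - {0}. a + 1 / w \<in> outside \<Omega>} \<union> ball 0 r"
    using ball \<open>r > 0\<close> assms by (auto simp: inverted_outside_iff)
  ultimately show ?thesis by (metis open_Un open_ball)
qed

text \<open>The outside of a bounded planar set is connected, hence so is its image. Adding
  \<open>0\<close> keeps it connected, since openness makes \<open>0\<close> a limit point of the
  image.\<close>

lemma connected_inverted_outside:
  assumes "compact \<Omega>" "a \<in> \<Omega>"
  shows "connected (inverted_outside \<Omega> a)"
proof -
  define U' where "U' = (\<lambda>z. 1 / (z - a)) ` outside \<Omega>"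
  have "a \<notin> outside \<Omega>" using assms outside_no_overlap by blast
  then have "connected U'"
    unfolding U'_def using assms compact_imp_bounded
    by (intro connected_continuous_image connected_outside continuous_intros) auto
  have io: "inverted_outside \<Omega> a = insert 0 U'"
    by (simp add: inverted_outside_def U'_def)
  have "0 \<in> interior (inverted_outside \<Omega> a)"
    using open_inverted_outside[OF assms] io by (simp add: interior_open)
  then have "0 islimpt inverted_outside \<Omega> a"
    by (rule interior_limit_point)
  then have "0 \<in> closure U'"
    by (simp add: io islimpt_insert closure_def)
  then have "insert 0 U' \<subseteq> closure U'"
    using closure_subset[of U'] by blast
  with \<open>connected U'\<close> show ?thesis
    unfolding io by (rule connected_intermediate_closure[OF _ subset_insertI])
qed

text \<open>A bounded component of the complement would, by Sura-Bura, lie in a compact relatively open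
  part of it; the inversion maps that part to a clopen part of the connected set
  \<open>- outside \<Omega>\<close> that omits \<open>a\<close>.\<close>

lemma simply_connected_inverted_outside:
  assumes "compact \<Omega>" "connected \<Omega>" "a \<in> \<Omega>"
  shows "simply_connected (inverted_outside \<Omega> a)"
proof -
  define V where "V = inverted_outside \<Omega> a"
  have V: "open V" "connected V" "0 \<in> V"
    unfolding V_def using open_inverted_outside[OF assms(1,3)] connected_inverted_outside[OF assms(1,3)]
    by (auto simp: inverted_outside_def)
  \<comment> \<open>An open connected planar set is simply connected exactly when no component of
    its complement is bounded.\<close>
  have unb: "\<not> bounded C" if C: "C \<in> components (- V)" for C
  proof
    assume "bounded C"
    have "closed (- V)" using V by auto
    then have "compact C"
      using C \<open>bounded C\<close> closed_components compact_eq_bounded_closed by blast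
    obtain K where K: "openin (top_of_set (- V)) K" "compact K" "C \<subseteq> K" "K \<subseteq> UNIV"
      by (rule Sura_Bura_clopen_subset[OF closed_imp_locally_compact[OF \<open>closed (- V)\<close>] C
            \<open>compact C\<close> open_UNIV subset_UNIV])
    obtain T where T: "open T" "K = - V \<inter> T"
      using K(1) by (auto simp: openin_open)
    have "0 \<notin> K" using T V by auto
    define L where "L = (\<lambda>w. a + 1 / w) ` K"
    have "compact L"
      unfolding L_def using \<open>0 \<notin> K\<close> K(2)
      by (intro compact_continuous_image continuous_intros) auto
    have "K \<noteq> {}"
      using K(3) C in_components_nonempty by blast
    then have "L \<noteq> {}" by (simp add: L_def)
    \<comment> \<open>\<open>X\<close> is \<Omega> with its holes filled; the inversion matches
      \<open>X - {a}\<close> with the nonzero points of \<open>- V\<close>.\<close>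
    define X where "X = \<Omega> \<union> inside \<Omega>"
    have X: "X = - outside \<Omega>" by (simp add: X_def union_with_inside)
    have "connected X"
      unfolding X_def using assms compact_imp_closed connected_with_inside by blast
    have mem: "z \<in> L \<longleftrightarrow> z \<noteq> a \<and> 1 / (z - a) \<in> K" for z
    proof
      assume "z \<noteq> a \<and> 1 / (z - a) \<in> K"
      then show "z \<in> L"
        unfolding L_def by (intro image_eqI[of _ _ "1 / (z - a)"]) auto
    qed (use \<open>0 \<notin> K\<close> in \<open>auto simp: L_def\<close>)
    \<comment> \<open>This exhibits \<open>L\<close> as relatively open in \<open>X\<close>;
      compactness makes it closed as well.\<close>
    have LX: "L = X \<inter> ((\<lambda>z. 1 / (z - a)) -` T \<inter> - {a})"
      using assms(3) by (auto simp: mem T X V_def inverted_outside_iff)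
    have "open ((\<lambda>z. 1 / (z - a)) -` T \<inter> - {a})"
    proof -
      have "continuous_on (- {a}) (\<lambda>z. 1 / (z - a))"
        by (intro continuous_intros) auto
      from continuous_open_preimage[OF this open_Compl[OF closed_singleton] T(1)] show ?thesis
        by (simp add: Int_commute)
    qed
    then have "openin (top_of_set X) L"
      unfolding LX by blast
    moreover have "closedin (top_of_set X) L"
      using \<open>compact L\<close> LX compact_imp_closed by (metis Int_lower1 closed_subset)
    ultimately have "L = X"
      using \<open>connected X\<close> \<open>L \<noteq> {}\<close> unfolding connected_clopen by blast
    moreover have "a \<in> X" "a \<notin> L"
      using assms(3) mem by (auto simp: X_def)
    ultimately show False by blast
  qed
  show ?thesis
    using V(2) unb simply_connected_eq_unbounded_complement_components[OF V(1)] unfolding V_def[symmetric]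
    by blast
qed

text \<open>A Riemann map followed by a disk automorphism that moves the image of \<open>0\<close>
  to the origin. Since \<open>0\<close> stands for infinity, this normalization puts the logarithmic
  pole of the Green function there.\<close>

lemma Riemann_map_fixing_0:
  assumes "open V" "simply_connected V" "V \<noteq> UNIV" "0 \<in> V"
  obtains F H where "F holomorphic_on V" "H holomorphic_on ball 0 1" "F 0 = (0::complex)"
    "\<And>w. w \<in> V \<Longrightarrow> F w \<in> ball 0 1 \<and> H (F w) = w"
    "\<And>z. z \<in> ball 0 1 \<Longrightarrow> H z \<in> V \<and> F (H z) = z"
proof -
  obtain f g where fg: "f holomorphic_on V" "g holomorphic_on ball 0 1"
    "\<forall>z \<in> V. f z \<in> ball 0 1 \<and> g(f z) = z"
    "\<forall>z \<in> ball 0 1. g z \<in> V \<and> f(g z) = z"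
    using Riemann_mapping_theorem[of V] assms by blast
  have "f 0 \<in> ball 0 1" using fg assms by blast
  then obtain \<phi> \<psi> where ps: "\<phi> (f 0) = 0"
      "\<phi> holomorphic_on ball 0 1" "\<phi> ` ball 0 1 \<subseteq> ball 0 1"
      "\<psi> holomorphic_on ball 0 1" "\<psi> ` ball 0 1 \<subseteq> ball 0 1"
      "\<And>z. z \<in> ball 0 1 \<Longrightarrow> \<phi> (\<psi> z) = z" "\<And>z. z \<in> ball 0 1 \<Longrightarrow> \<psi> (\<phi> z) = z"
    using ball_biholomorphism_exists by blast
  show thesis
  proof (rule that[of "\<phi> \<circ> f" "g \<circ> \<psi>"])
    show "\<phi> \<circ> f holomorphic_on V"
      by (rule holomorphic_on_compose_gen[OF fg(1) ps(2)]) (use fg in auto)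
    show "g \<circ> \<psi> holomorphic_on ball 0 1"
      by (rule holomorphic_on_compose_gen[OF ps(4) fg(2) ps(5)])
    show "(\<phi> \<circ> f) w \<in> ball 0 1 \<and> (g \<circ> \<psi>) ((\<phi> \<circ> f) w) = w" if "w \<in> V" for w
    proof -
      have "f w \<in> ball 0 1" "g (f w) = w" using fg that by blast+
      moreover from this have "\<phi> (f w) \<in> ball 0 1" using ps(3) by blast
      ultimately show ?thesis using ps(7) by simp
    qed
    show "(g \<circ> \<psi>) z \<in> V \<and> (\<phi> \<circ> f) ((g \<circ> \<psi>) z) = z" if "z \<in> ball 0 1" for z
    proof -
      have "\<psi> z \<in> ball 0 1" using ps(5) that by blast
      then show ?thesis using ps(6)[OF that] fg(4) by simp
    qed
  qed (simp add: ps)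
qed

text \<open>Bounded components of \<open>- \<Omega>\<close> are not excluded (the Warsaw circle is simply connected); there
  the solution is \<open>0\<close>.\<close>

lemma exterior_laplace_solution_exists:
  assumes "compact \<Omega>" "connected \<Omega>" "a \<in> \<Omega>" "b \<in> \<Omega>" "a \<noteq> b"
  shows "\<exists>G. exterior_laplace_solution \<Omega> G"
proof -
  define U where "U = outside \<Omega>"
  define V where "V = inverted_outside \<Omega> a"
  have "closed \<Omega>" using assms compact_imp_closed by blast
  then have opn: "open U" "open (inside \<Omega>)"
    unfolding U_def by (auto intro: open_outside open_inside)
  have disj: "U \<inter> \<Omega> = {}" "U \<inter> inside \<Omega> = {}"
    and un: "- \<Omega> = U \<union> inside \<Omega>"
    unfolding U_def using inside_Un_outside[of \<Omega>] inside_Int_outside[of \<Omega>] by blast+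
  have V_iff: "w \<in> V \<longleftrightarrow> w = 0 \<or> a + 1 / w \<in> U" for w
    unfolding V_def U_def by (rule inverted_outside_iff) fact
  have V: "open V" "simply_connected V" "0 \<in> V"
    unfolding V_def using open_inverted_outside simply_connected_inverted_outside assms
    by (auto simp: inverted_outside_def)
  \<comment> \<open>The second point \<open>b\<close> provides a point outside \<open>V\<close>, so
    that \<open>V\<close> is a proper subset of the plane and has a Riemann map onto the
    disk.\<close>
  have "1 / (b - a) \<notin> V"
    unfolding V_iff using assms disj by auto
  then have "V \<noteq> UNIV" by blast
  obtain F H where F: "F holomorphic_on V" and H: "H holomorphic_on ball 0 1" and F0: "F 0 = 0"
    and FH: "\<And>w. w \<in> V \<Longrightarrow> F w \<in> ball 0 1 \<and> H (F w) = w"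
    and HF: "\<And>z. z \<in> ball 0 1 \<Longrightarrow> H z \<in> V \<and> F (H z) = z"
    using Riemann_map_fixing_0[OF V(1,2) \<open>V \<noteq> UNIV\<close> V(3)] by metis
  have injF: "inj_on F V"
    using FH by (metis inj_onI)
  define h where "h = (\<lambda>z. F (1 / (z - a)))"
  define G where "G = (\<lambda>z. if z \<in> U then - ln (cmod (h z)) else 0)"
  have UV: "z \<noteq> a" "1 / (z - a) \<in> V" if "z \<in> U" for z
    using that disj assms by (auto simp: V_iff)
  \<comment> \<open>\<open>F\<close> is injective and vanishes at \<open>0\<close>, whereas
    \<open>1 / (z - a)\<close> is nonzero on \<open>U\<close>.\<close>
  have h: "h z \<noteq> 0" "cmod (h z) < 1" if "z \<in> U" for z
  proof -
    show "cmod (h z) < 1" using FH UV[OF that] by (simp add: h_def)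
    show "h z \<noteq> 0"
      using inj_onD[OF injF, of "1 / (z - a)" 0] F0 UV[OF that] V(3) by (auto simp: h_def)
  qed
  have "F \<circ> (\<lambda>z. 1 / (z - a)) holomorphic_on U"
    by (rule holomorphic_on_compose_gen[OF _ F]) (use UV in \<open>auto intro!: holomorphic_intros\<close>)
  then have hol: "h holomorphic_on U"
    by (simp add: h_def o_def)

  \<comment> \<open>The complex gradient of \<open>G\<close>. Its two pieces live on the disjoint
    open sets \<open>U\<close> and \<open>inside \<Omega>\<close>, so together they are
    holomorphic.\<close>
  define \<phi> where "\<phi> = (\<lambda>z. if z \<in> U then - (deriv h z / h z) else 0)"
  have "\<phi> holomorphic_on U"
    by (rule holomorphic_transform[of "\<lambda>z. - (deriv h z / h z)"])
       (use h hol opn in \<open>auto simp: \<phi>_def intro!: holomorphic_intros\<close>)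
  moreover have "\<phi> holomorphic_on inside \<Omega>"
    by (rule holomorphic_transform[of "\<lambda>z. 0"]) (use disj in \<open>auto simp: \<phi>_def\<close>)
  ultimately have \<phi>: "\<phi> holomorphic_on - \<Omega>"
    unfolding un using opn by (intro holomorphic_on_Un) auto
  have G': "(G has_derivative (\<lambda>k. Re (\<phi> z * k))) (at z)" if "z \<in> - \<Omega>" for z
  proof (cases "z \<in> U")
    case True
    have "((\<lambda>z. - ln (cmod (h z))) has_derivative (\<lambda>k. - Re (deriv h z / h z * k))) (at z)"
      using hol opn True h
      by (intro has_derivative_minus has_derivative_ln_cmod holomorphic_derivI) auto
    then have "((\<lambda>z. - ln (cmod (h z))) has_derivative (\<lambda>k. Re (\<phi> z * k))) (at z)"
      using True by (simp add: \<phi>_def)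
    then show ?thesis
      by (rule has_derivative_transform_within_open[OF _ opn(1) True]) (simp add: G_def)
  next
    case False
    then have "z \<in> inside \<Omega>" using that un by blast
    have "((\<lambda>z. 0) has_derivative (\<lambda>k. Re (\<phi> z * k))) (at z)"
      using False by (simp add: \<phi>_def)
    then show ?thesis
      by (rule has_derivative_transform_within_open[OF _ opn(2) \<open>z \<in> inside \<Omega>\<close>])
         (use disj in \<open>auto simp: G_def\<close>)
  qed
  have "harmonic_on (- \<Omega>) G"
    using \<open>closed \<Omega>\<close> \<phi> G' by (intro harmonic_on_complex_gradient) auto

  \<comment> \<open>Boundary values come from properness of the Riemann map: the set
    \<open>L\<close> of points of \<open>V\<close> with \<open>|F| \<le> exp (- \<epsilon>)\<close>
    is compact. As \<open>z\<close> approaches \<Omega>, the inverted point leaves \<open>L\<close>,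
    which gives \<open>0 \<le> G z < \<epsilon>\<close>.\<close>
  have lim0: "(G \<longlongrightarrow> 0) (at z0)" if "z0 \<in> \<Omega>" for z0
  proof (rule tendstoI)
    fix \<epsilon> :: real assume "\<epsilon> > 0"
    define L where "L = H ` cball 0 (exp (- \<epsilon>))"
    have sub: "cball 0 (exp (- \<epsilon>)) \<subseteq> ball (0::complex) 1"
    proof
      fix x :: complex assume "x \<in> cball 0 (exp (- \<epsilon>))"
      then have "cmod x \<le> exp (- \<epsilon>)" by simp
      also have "\<dots> < 1" using \<open>\<epsilon> > 0\<close> by simp
      finally show "x \<in> ball 0 1" by simp
    qed
    have "compact L"
      unfolding L_def
      by (intro compact_continuous_image holomorphic_on_imp_continuous_on holomorphic_on_subset[OF H sub])
         auto
    have "L \<subseteq> V" using sub HF by (auto simp: L_def simp del: mem_ball mem_cball)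
    have "eventually (\<lambda>z. 1 / (z - a) \<notin> L) (at z0)"
    proof (cases "z0 = a")
      \<comment> \<open>At the centre of the inversion \<open>1 / (z - a)\<close> tends to infinity
        and thus leaves the bounded set \<open>L\<close>.\<close>
      case True
      obtain B where B: "\<And>w. w \<in> L \<Longrightarrow> cmod w \<le> B"
        using compact_imp_bounded[OF \<open>compact L\<close>] by (auto simp: bounded_iff)
      have "filterlim (\<lambda>z. z - a) (at 0) (at a)"
        by (rule filterlim_atI) (auto intro!: tendsto_eq_intros simp: eventually_at_filter)
      then have "filterlim (\<lambda>z. inverse (z - a)) at_infinity (at a)"
        by (rule filterlim_compose[OF filterlim_inverse_at_infinity])
      then have "eventually (\<lambda>z. cmod (inverse (z - a)) \<ge> \<bar>B\<bar> + 1) (at a)"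
        by (simp add: filterlim_at_infinity[of 0])
      then show ?thesis
        unfolding True
      proof eventually_elim
        case (elim z)
        then show ?case using B[of "1 / (z - a)"] by (auto simp: inverse_eq_divide)
      qed
    next
      case False
      \<comment> \<open>Here the inverted points converge to a point outside \<open>V\<close>, hence
        outside the closed set \<open>L\<close>.\<close>
      have "1 / (z0 - a) \<notin> V" unfolding V_iff using False disj that by auto
      then have "1 / (z0 - a) \<in> - L" using \<open>L \<subseteq> V\<close> by blast
      moreover have "((\<lambda>z. 1 / (z - a)) \<longlongrightarrow> 1 / (z0 - a)) (at z0)"
        using False by (intro tendsto_intros) auto
      moreover have "open (- L)" using \<open>compact L\<close> compact_imp_closed by blast
      ultimately have "eventually (\<lambda>z. 1 / (z - a) \<in> - L) (at z0)"
        using topological_tendstoD by blast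
      then show ?thesis by simp
    qed
    then show "eventually (\<lambda>z. dist (G z) 0 < \<epsilon>) (at z0)"
    proof eventually_elim
      case (elim z)
      show ?case
      proof (cases "z \<in> U")
        case True
        have "cmod (h z) > exp (- \<epsilon>)"
        proof (rule ccontr)
          assume "\<not> ?thesis"
          then have "H (h z) \<in> L" by (simp add: L_def)
          then show False using elim FH UV[OF True] by (simp add: h_def)
        qed
        then have "ln (cmod (h z)) > - \<epsilon>"
          using h(1)[OF True] by (metis exp_less_cancel_iff exp_ln zero_less_norm_iff)
        moreover have "ln (cmod (h z)) \<le> 0"
          using h[OF True] by simp
        ultimately show ?thesis using True by (simp add: G_def)
      qed (use \<open>\<epsilon> > 0\<close> in \<open>simp add: G_def\<close>)
    qed
  qed
  have "isCont G z" for z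
  proof (cases "z \<in> \<Omega>")
    case True
    then show ?thesis
      using lim0[OF True] disj by (auto simp: isCont_def G_def)
  next
    case False
    then show ?thesis using has_derivative_continuous[OF G'] by simp
  qed
  then have cont: "continuous_on (- interior \<Omega>) G"
    by (simp add: continuous_at_imp_continuous_on)

  \<comment> \<open>Behaviour at infinity: \<open>h z * z\<close> tends to \<open>c = F'(0)\<close>,
    which is nonzero by injectivity. So \<open>ln |h z| + ln |z|\<close> has a finite limit, and
    \<open>G z / ln |z|\<close> tends to \<open>1\<close>.\<close>
  define c where "c = deriv F 0"
  have "c \<noteq> 0"
    unfolding c_def by (rule holomorphic_injective_imp_regular[OF F V(1) injF V(3)])
  have inv: "filterlim (\<lambda>z. 1 / (z - a)) (at 0) at_infinity"
  proof -
    have "filterlim (\<lambda>z. z - a) at_infinity at_infinity"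
      using tendsto_add_filterlim_at_infinity[OF tendsto_const[of "- a"] filterlim_ident] by simp
    then show ?thesis
      by (simp add: filterlim_inverse_at_iff flip: inverse_eq_divide)
  qed
  have "(F has_field_derivative c) (at 0)"
    unfolding c_def using F V by (intro holomorphic_derivI) auto
  then have "((\<lambda>w. F w / w) \<longlongrightarrow> c) (at 0)"
    by (simp add: DERIV_def F0)
  then have 1: "((\<lambda>z. F (1 / (z - a)) / (1 / (z - a))) \<longlongrightarrow> c) at_infinity"
    by (rule filterlim_compose) (rule inv)
  \<comment> \<open>The factor \<open>1 + a / (z - a) = z / (z - a)\<close> turns
    \<open>h z * (z - a)\<close>, the difference quotient of \<open>F\<close>, into
    \<open>h z * z\<close>.\<close>
  have "((\<lambda>z. 1 + a * (1 / (z - a))) \<longlongrightarrow> 1 + a * 0) at_infinity"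
    using inv by (intro tendsto_intros) (simp add: filterlim_at)
  with 1 have "((\<lambda>z. F (1 / (z - a)) / (1 / (z - a)) * (1 + a * (1 / (z - a)))) \<longlongrightarrow> c * (1 + a * 0)) at_infinity"
    by (rule tendsto_mult)
  moreover have "eventually (\<lambda>z. z \<noteq> a) at_infinity"
    unfolding eventually_at_infinity by (rule exI[of _ "cmod a + 1"]) auto
  then have "eventually (\<lambda>z. F (1 / (z - a)) / (1 / (z - a)) * (1 + a * (1 / (z - a))) = h z * z) at_infinity"
  proof eventually_elim
    case (elim z)
    then have "(z - a) * (1 + a * (1 / (z - a))) = z"
      by (simp add: field_simps)
    then show ?case by (simp add: h_def mult.assoc)
  qed
  ultimately have "((\<lambda>z. h z * z) \<longlongrightarrow> c) at_infinity"
    by (simp add: tendsto_cong)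
  then have "((\<lambda>z. ln (cmod (h z * z))) \<longlongrightarrow> ln (cmod c)) at_infinity"
    using \<open>c \<noteq> 0\<close> by (intro tendsto_intros) auto
  moreover have "filterlim (\<lambda>z::complex. ln (cmod z)) at_top at_infinity"
    by (rule filterlim_compose[OF ln_at_top filterlim_norm_at_top])
  ultimately have "((\<lambda>z. 1 - ln (cmod (h z * z)) / ln (cmod z)) \<longlongrightarrow> 1 - 0) at_infinity"
    by (intro tendsto_diff tendsto_const tendsto_divide_0 filterlim_at_top_imp_at_infinity)
  moreover have "eventually (\<lambda>z. 1 - ln (cmod (h z * z)) / ln (cmod z) = G z / ln (cmod z)) at_infinity"
  proof -
    obtain R where R: "\<And>z. cmod z > R \<Longrightarrow> z \<in> U"
      using large_in_outside[of \<Omega>] compact_imp_bounded[OF assms(1)] unfolding U_def by metis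
    have "1 - ln (cmod (h z * z)) / ln (cmod z) = G z / ln (cmod z)" if "cmod z \<ge> max (R + 1) 2" for z
    proof -
      have "z \<in> U" "cmod z > 1" using R[of z] that by auto
      then have "ln (cmod z) > 0" by (intro ln_gt_zero)
      moreover have "ln (cmod (h z * z)) = ln (cmod (h z)) + ln (cmod z)"
        unfolding norm_mult using h(1)[OF \<open>z \<in> U\<close>] \<open>cmod z > 1\<close> by (auto simp: ln_mult)
      ultimately show ?thesis
        using \<open>z \<in> U\<close> by (simp add: G_def field_simps)
    qed
    then show ?thesis unfolding eventually_at_infinity by blast
  qed
  ultimately have "((\<lambda>z. G z / ln (cmod z)) \<longlongrightarrow> 1) at_infinity"
    by (simp add: tendsto_cong)
  moreover have "G z = 0" if "z \<in> frontier \<Omega>" for z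
    using that \<open>closed \<Omega>\<close> frontier_subset_closed disj by (auto simp: G_def)
  ultimately have "exterior_laplace_solution \<Omega> G"
    unfolding exterior_laplace_solution_def using \<open>harmonic_on (- \<Omega>) G\<close> cont by blast
  then show ?thesis by blast
qed

subsection \<open>Coefficients and values on the unit circle\<close>

text \<open>Orthogonality of the characters of the cyclic group of order \<open>N + 1\<close>. The
  bounds on \<open>m\<close> and \<open>n\<close> ensure that exponents congruent modulo
  \<open>N + 1\<close> are equal.\<close>

lemma sum_roots_of_unity_power:
  fixes m n N :: nat
  assumes "m \<le> N" "n \<le> N"
  shows "(\<Sum>j\<le>N. cis (2 * pi * j / Suc N) ^ m * cnj (cis (2 * pi * j / Suc N) ^ n)) =
         (if m = n then of_nat (Suc N) else 0)"
proof -
  \<comment> \<open>The summands are the powers of \<open>x\<close>, itself a root of unity of order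
    dividing \<open>N + 1\<close>, so the sum is geometric.\<close>
  define x where "x = cis (2 * pi * (real m - real n) / Suc N)"
  have eq: "cis (2 * pi * j / Suc N) ^ m * cnj (cis (2 * pi * j / Suc N) ^ n) = x ^ j" for j :: nat
  proof -
    have "cis (2 * pi * j / Suc N) ^ m * cnj (cis (2 * pi * j / Suc N) ^ n) =
        cis (real m * (2 * pi * j / Suc N) - real n * (2 * pi * j / Suc N))"
      by (simp only: Complex.DeMoivre cis_cnj cis_mult diff_conv_add_uminus)
    also have "real m * (2 * pi * j / Suc N) - real n * (2 * pi * j / Suc N) =
        real j * (2 * pi * (real m - real n) / Suc N)"
      by (simp only: times_divide_eq_right diff_divide_distrib[symmetric]) (simp add: algebra_simps)
    finally show ?thesis
      by (simp only: x_def Complex.DeMoivre)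
  qed
  have "x ^ Suc N = cis (2 * pi * of_int (int m - int n))"
    unfolding x_def Complex.DeMoivre by simp
  also have "\<dots> = 1"
    by (rule cis_multiple_2pi) simp
  finally have xN: "x ^ Suc N = 1" .
  show ?thesis
  proof (cases "m = n")
    case True
    then have "x = 1" by (simp add: x_def)
    then show ?thesis unfolding eq using True by simp
  next
    case False
    have "x \<noteq> 1"
    proof
      assume "x = 1"
      then have "cos (2 * pi * (real m - real n) / Suc N) = 1"
        by (simp add: x_def complex_eq_iff)
      then obtain k :: int where "2 * pi * (real m - real n) / Suc N = of_int k * 2 * pi"
        by (auto simp: cos_one_2pi_int)
      then have "2 * pi * ((real m - real n) / Suc N) = 2 * pi * of_int k"
        by (simp only: times_divide_eq_right mult_ac)
      then have "(real m - real n) / Suc N = of_int k"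
        by (subst (asm) mult_cancel_left) simp
      then have "real m - real n = of_int k * real (Suc N)"
        by (simp only: divide_eq_eq)
      then have "real_of_int (int m - int n) = real_of_int (k * int (Suc N))"
        by simp
      then have "int m - int n = k * int (Suc N)"
        by (simp only: of_int_eq_iff)
      \<comment> \<open>\<open>x = 1\<close> would make \<open>N + 1\<close> divide a nonzero
        integer of absolute value at most \<open>N\<close>.\<close>
      then have "int (Suc N) dvd \<bar>int m - int n\<bar>" by simp
      moreover have "\<bar>int m - int n\<bar> < int (Suc N)" "0 < \<bar>int m - int n\<bar>"
        using assms False by auto
      ultimately show False
        using zdvd_not_zless by blast
    qed
    then have "(\<Sum>j\<le>N. x ^ j) = 0"
      unfolding lessThan_Suc_atMost[symmetric] by (subst geometric_sum) (simp_all only: xN diff_self div_0 not_False_eq_True)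
    then show ?thesis unfolding eq using False by simp
  qed
qed

text \<open>Discrete Parseval identity: for degree at most \<open>N\<close>, the mean of
  \<open>|p|^2\<close> over the roots of unity of order \<open>N + 1\<close> equals the sum of the
  squared moduli of the coefficients.\<close>

lemma L2_set_coeff_le:
  fixes p :: "complex poly"
  assumes "degree p \<le> N" and M: "\<And>z. z \<in> ball 0 1 \<Longrightarrow> cmod (poly p z) \<le> M"
  shows "L2_set (\<lambda>k. cmod (coeff p k)) {..N} \<le> M"
proof -
  \<comment> \<open>The bound is assumed on the open disk, but the roots of unity lie on its
    boundary circle; continuity extends it.\<close>
  have "continuous_on (closure (ball (0::complex) 1)) (\<lambda>z. cmod (poly p z))"
    by (intro continuous_intros)
  then have circ: "cmod (poly p z) \<le> M" if "cmod z = 1" for z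
    using continuous_le_on_closure[of "ball (0::complex) 1" "\<lambda>z. cmod (poly p z)" z M] M that by auto
  have "M \<ge> 0" using order_trans[OF norm_ge_zero M[of 0]] by simp
  define \<omega> where "\<omega> = (\<lambda>j::nat. cis (2 * pi * j / Suc N))"
  have p: "poly p z = (\<Sum>k\<le>N. coeff p k * z ^ k)" for z
    using poly_as_sum_of_monoms'[OF assms(1)] by (metis (no_types, lifting) poly_monom poly_sum sum.cong)
  have "of_real (\<Sum>j\<le>N. (cmod (poly p (\<omega> j)))\<^sup>2) = (\<Sum>j\<le>N. poly p (\<omega> j) * cnj (poly p (\<omega> j)))"
    by (simp only: of_real_sum complex_norm_square)
  also have "\<dots> = (\<Sum>j\<le>N. \<Sum>k\<le>N. \<Sum>l\<le>N. coeff p k * cnj (coeff p l) * (\<omega> j ^ k * cnj (\<omega> j ^ l)))"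
    by (simp add: p sum_product mult_ac)
  also have "\<dots> = (\<Sum>k\<le>N. \<Sum>l\<le>N. coeff p k * cnj (coeff p l) * (\<Sum>j\<le>N. \<omega> j ^ k * cnj (\<omega> j ^ l)))"
    by (subst sum.swap, rule sum.cong[OF refl], subst sum.swap) (simp add: sum_distrib_left)
  also have "\<dots> = (\<Sum>k\<le>N. \<Sum>l\<le>N. if k = l then coeff p k * cnj (coeff p l) * of_nat (Suc N) else 0)"
    unfolding \<omega>_def by (intro sum.cong refl, subst sum_roots_of_unity_power) auto
  also have "\<dots> = (\<Sum>k\<le>N. coeff p k * cnj (coeff p k) * of_nat (Suc N))"
    by simp
  also have "\<dots> = of_real (Suc N * (\<Sum>k\<le>N. (cmod (coeff p k))\<^sup>2))"
    by (simp only: of_real_mult of_real_sum complex_norm_square of_real_of_nat_eq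
        sum_distrib_left[symmetric] mult.commute)
  finally have "(\<Sum>j\<le>N. (cmod (poly p (\<omega> j)))\<^sup>2) = Suc N * (\<Sum>k\<le>N. (cmod (coeff p k))\<^sup>2)"
    by (simp only: of_real_eq_iff)
  moreover have "(\<Sum>j\<le>N. (cmod (poly p (\<omega> j)))\<^sup>2) \<le> (\<Sum>j\<le>N. M\<^sup>2)"
    by (intro sum_mono power_mono circ) (auto simp: \<omega>_def)
  ultimately have "(\<Sum>k\<le>N. (cmod (coeff p k))\<^sup>2) \<le> M\<^sup>2"
    by simp
  then show ?thesis
    unfolding L2_set_def using \<open>M \<ge> 0\<close> real_le_lsqrt by (simp add: real_sqrt_le_iff real_le_lsqrt)
qed

subsection \<open>The coefficient bound\<close>

lemma le_sup_norm: "x \<in> \<Omega> \<Longrightarrow> ennreal (cmod (g x)) \<le> sup_norm \<Omega> g"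
  unfolding sup_norm_def by (rule SUP_upper)

lemma sup_norm_le: "(\<And>x. x \<in> \<Omega> \<Longrightarrow> cmod (g x) \<le> B) \<Longrightarrow> sup_norm \<Omega> g \<le> ennreal B"
  unfolding sup_norm_def by (intro SUP_least ennreal_leI)

lemma sup_norm_le_ennrealD:
  assumes "sup_norm \<Omega> g \<le> ennreal B" "B \<ge> 0" "x \<in> \<Omega>"
  shows "cmod (g x) \<le> B"
  using order_trans[OF le_sup_norm[OF assms(3)] assms(1)] assms(2) by simp

lemma interpolates_unique:
  assumes "inj_on z {..N}" "interpolates N z g p" "interpolates N z g q"
  shows "p = q"
proof (rule ccontr)
  assume "p \<noteq> q"
  then have "p - q \<noteq> 0" by simp
  have "z ` {..N} \<subseteq> {x. poly (p - q) x = 0}"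
    using assms(2,3) by (auto simp: interpolates_def)
  then have "card (z ` {..N}) \<le> card {x. poly (p - q) x = 0}"
    by (intro card_mono poly_roots_finite \<open>p - q \<noteq> 0\<close>)
  also have "\<dots> \<le> degree (p - q)"
    by (rule card_poly_roots_bound) fact
  also have "\<dots> \<le> N"
    using assms(2,3) degree_diff_le by (auto simp: interpolates_def)
  finally show False
    using assms(1) by (simp add: card_image)
qed

lemma interp_poly_eq:
  assumes "inj_on z {..N}" "interpolates N z g p"
  shows "interp_poly N z g = p"
  unfolding interp_poly_def using assms interpolates_unique by blast

text \<open>Only the values of \<open>g\<close> at the nodes matter, so the Lebesgue constant also bounds the
  interpolation of functions that are not continuous.\<close>

lemma sup_norm_interpolant_le:
  assumes inj: "inj_on z {..N}" and sub: "z ` {..N} \<subseteq> \<Omega>" and p: "interpolates N z g p"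
    and B: "\<And>j. j \<le> N \<Longrightarrow> cmod (g (z j)) \<le> B"
  shows "sup_norm \<Omega> (poly p) \<le> lebesgue_constant \<Omega> N z * ennreal B"
\<comment> \<open>If all node values vanish, a continuous extension might be zero on \<Omega> and so
  be inadmissible in the supremum; then \<open>p = 0\<close> by uniqueness.\<close>
proof (cases "\<forall>j\<le>N. g (z j) = 0")
  case True
  then have "interpolates N z g 0" by (simp add: interpolates_def)
  then have "p = 0" using interpolates_unique[OF inj p] by simp
  then have "sup_norm \<Omega> (poly p) \<le> ennreal 0"
    by (intro sup_norm_le) simp
  then show ?thesis by simp
next
  case False
  then obtain j where j: "j \<le> N" "g (z j) \<noteq> 0" by blast
  have "B \<ge> 0" using order_trans[OF norm_ge_zero B[OF j(1)]] .
  have "continuous_on (z ` {..N}) g" "closedin (top_of_set UNIV) (z ` {..N})"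
    by (auto intro: continuous_on_finite finite_imp_closed)
  \<comment> \<open>Tietze extension of the node values to a continuous function with the same bound
    \<open>B\<close>.\<close>
  then obtain h where h: "continuous_on UNIV h" "\<And>x. x \<in> z ` {..N} \<Longrightarrow> h x = g x"
      "\<And>x. x \<in> UNIV \<Longrightarrow> cmod (h x) \<le> B"
    by (rule Tietze[of _ _ _ B]) (use B \<open>B \<ge> 0\<close> in auto)
  have "interpolates N z h p"
    using p h(2) by (auto simp: interpolates_def)
  then have ip: "interp_poly N z h = p" by (rule interp_poly_eq[OF inj])
  have zj: "z j \<in> \<Omega>" "h (z j) \<noteq> 0" using sub j h(2) by auto
  have "continuous_on \<Omega> h" using h(1) continuous_on_subset by blast
  then have q: "sup_norm \<Omega> (poly p) / sup_norm \<Omega> h \<le> lebesgue_constant \<Omega> N z"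
    unfolding lebesgue_constant_def using zj
    by (intro SUP_upper2[of h]) (auto simp: ip)
  have hB: "sup_norm \<Omega> h \<le> ennreal B" by (rule sup_norm_le) (simp add: h)
  \<comment> \<open>Cancelling in \<open>ennreal\<close> needs a divisor that is neither zero nor
    infinite.\<close>
  have "0 < ennreal (cmod (h (z j)))" using zj by simp
  also have "\<dots> \<le> sup_norm \<Omega> h" by (rule le_sup_norm) fact
  finally have "sup_norm \<Omega> (poly p) = sup_norm \<Omega> (poly p) / sup_norm \<Omega> h * sup_norm \<Omega> h"
    using le_less_trans[OF hB ennreal_less_top] by (simp add: ennreal_divide_times)
  also have "\<dots> \<le> lebesgue_constant \<Omega> N z * ennreal B"
    by (intro mult_mono q hB) auto
  finally show ?thesis .
qed

text \<open>Existence is what makes the \<open>SOME\<close> in \<open>green_function\<close> pick an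
  actual solution.\<close>

lemma exterior_laplace_solution_green_function:
  assumes "compact \<Omega>" "connected \<Omega>" "a \<in> \<Omega>" "b \<in> \<Omega>" "a \<noteq> b"
  shows "exterior_laplace_solution \<Omega> (green_function \<Omega>)"
  unfolding green_function_def by (rule someI_ex[OF exterior_laplace_solution_exists[OF assms]])

lemma poly_le_on_level_region:
  assumes "compact \<Omega>" "\<Omega> \<noteq> {}" "exterior_laplace_solution \<Omega> (green_function \<Omega>)"
    and p: "\<And>w. w \<in> \<Omega> \<Longrightarrow> cmod (poly p w) \<le> M" and "degree p \<le> n"
    and "\<rho> > 1" "z \<in> level_region \<Omega> \<rho>"
  shows "cmod (poly p z) \<le> M * \<rho> ^ n"
proof -
  obtain x where "x \<in> \<Omega>" using \<open>\<Omega> \<noteq> {}\<close> by auto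
  then have "M \<ge> 0" using order_trans[OF norm_ge_zero p] by blast
  show ?thesis
  proof (cases "z \<in> \<Omega>")
    case True
    have "M * 1 \<le> M * \<rho> ^ n"
      using \<open>M \<ge> 0\<close> \<open>\<rho> > 1\<close> by (intro mult_left_mono one_le_power) auto
    then show ?thesis using p[OF True] by simp
  next
    case False
    then have "green_function \<Omega> z < ln \<rho>"
      using assms by (simp add: level_region_def)
    then have "exp (n * green_function \<Omega> z) \<le> exp (n * ln \<rho>)"
      by (simp add: mult_left_mono)
    also have "\<dots> = \<rho> ^ n"
      using \<open>\<rho> > 1\<close> by (subst exp_of_nat_mult, subst exp_ln) auto
    finally have "M * exp (n * green_function \<Omega> z) \<le> M * \<rho> ^ n"
      using \<open>M \<ge> 0\<close> by (rule mult_left_mono)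
    then show ?thesis
      using Bernstein_Walsh[OF assms(1-3) p assms(5) False] by linarith
  qed
qed

text \<open>The Green function is continuous on a compact set, hence bounded there by some
  \<open>B\<close>, and \<open>exp (B + 1)\<close> is admissible. The infimum defining
  \<open>rho_star\<close> is thus taken over a nonempty set.\<close>

lemma level_region_covers_unit_disk:
  assumes "exterior_laplace_solution \<Omega> (green_function \<Omega>)"
  shows "\<exists>\<rho>>1. ball 0 1 \<subseteq> level_region \<Omega> \<rho>"
proof -
  have "compact (- interior \<Omega> \<inter> cball 0 1)"
    by (intro closed_Int_compact) auto
  moreover have "continuous_on (- interior \<Omega> \<inter> cball 0 1) (green_function \<Omega>)"
    by (rule continuous_on_subset[of "- interior \<Omega>"])
       (use assms in \<open>simp_all add: exterior_laplace_solution_def\<close>)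
  ultimately have "compact (green_function \<Omega> ` (- interior \<Omega> \<inter> cball 0 1))"
    by (rule compact_continuous_image[rotated])
  then have "bounded (green_function \<Omega> ` (- interior \<Omega> \<inter> cball 0 1))"
    by (rule compact_imp_bounded)
  then obtain B where B: "B > 0" "\<And>z. z \<in> - interior \<Omega> \<inter> cball 0 1 \<Longrightarrow> \<bar>green_function \<Omega> z\<bar> \<le> B"
    unfolding bounded_pos by auto
  have "green_function \<Omega> z < ln (exp (B + 1))" if "z \<in> ball 0 1" "z \<notin> \<Omega>" for z
  proof -
    have "z \<in> - interior \<Omega> \<inter> cball 0 1"
      using that interior_subset[of \<Omega>] by auto
    from B(2)[OF this] show ?thesis by simp
  qed
  then show ?thesis
    using B(1) by (intro exI[of _ "exp (B + 1)"]) (auto simp: level_region_def)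
qed

lemma rho_star_ge_1:
  assumes "exterior_laplace_solution \<Omega> (green_function \<Omega>)"
  shows "rho_star \<Omega> \<ge> 1"
  unfolding rho_star_def
  by (rule cInf_greatest) (use level_region_covers_unit_disk[OF assms] in auto)

text \<open>The infimum need not be admissible itself. The bound, however, is a closed condition on
  \<rho> that holds for every admissible \<rho>, so it passes to the infimum.\<close>

lemma poly_le_on_unit_disk:
  assumes "compact \<Omega>" "\<Omega> \<noteq> {}" and sol: "exterior_laplace_solution \<Omega> (green_function \<Omega>)"
    and "\<And>w. w \<in> \<Omega> \<Longrightarrow> cmod (poly p w) \<le> M" and "degree p \<le> n" and "z \<in> ball 0 1"
  shows "cmod (poly p z) \<le> M * rho_star \<Omega> ^ n"
proof -
  define S where "S = {\<rho>. \<rho> > 1 \<and> ball 0 1 \<subseteq> level_region \<Omega> \<rho>}"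
  define T where "T = {\<rho>. cmod (poly p z) \<le> M * \<rho> ^ n}"
  have "closed T"
    unfolding T_def by (intro closed_Collect_le continuous_intros)
  moreover have "S \<subseteq> T"
    using poly_le_on_level_region[OF assms(1-5)] assms(6) unfolding S_def T_def by blast
  ultimately have "closure S \<subseteq> T" by (rule closure_minimal[rotated])
  moreover have "S \<noteq> {}"
    using level_region_covers_unit_disk[OF sol] by (auto simp: S_def)
  then have "Inf S \<in> closure S"
    by (rule closure_contains_Inf) (auto simp: S_def intro: bdd_belowI[of _ 1])
  ultimately have "Inf S \<in> T" by blast
  then show ?thesis by (simp add: T_def S_def rho_star_def)
qed

section \<open>The norm of the coefficient vector\<close>

definition coeff_norm :: "nat \<Rightarrow> complex poly \<Rightarrow> real" where
  "coeff_norm N p = L2_set (\<lambda>k. cmod (coeff p k)) {..N}"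

lemma coeff_norm_0 [simp]: "coeff_norm N 0 = 0"
  by (simp add: coeff_norm_def L2_set_def)

lemma coeff_norm_triangle: "coeff_norm N (p + q) \<le> coeff_norm N p + coeff_norm N q"
proof -
  have "coeff_norm N (p + q) \<le> L2_set (\<lambda>k. cmod (coeff p k) + cmod (coeff q k)) {..N}"
    unfolding coeff_norm_def by (intro L2_set_mono) (auto simp: norm_triangle_ineq)
  also have "\<dots> \<le> coeff_norm N p + coeff_norm N q"
    unfolding coeff_norm_def by (rule L2_set_triangle_ineq)
  finally show ?thesis .
qed

lemma coeff_norm_sum: "coeff_norm N (\<Sum>i\<in>A. f i) \<le> (\<Sum>i\<in>A. coeff_norm N (f i))"
  by (induction A rule: infinite_finite_induct)
     (auto intro: order_trans[OF coeff_norm_triangle])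

text \<open>Growth to the unit disk followed by Parseval. The exponent is the degree bound
  \<open>n\<close> of \<open>p\<close> itself, not \<open>N\<close>; this produces the different
  powers of \<open>rho_star\<close> in the final sum.\<close>

lemma coeff_norm_le:
  assumes "compact \<Omega>" "\<Omega> \<noteq> {}" "exterior_laplace_solution \<Omega> (green_function \<Omega>)"
    and "\<And>w. w \<in> \<Omega> \<Longrightarrow> cmod (poly p w) \<le> M" and "degree p \<le> n" "n \<le> N"
  shows "coeff_norm N p \<le> M * rho_star \<Omega> ^ n"
  unfolding coeff_norm_def using poly_le_on_unit_disk[OF assms(1-5)] assms(5,6)
  by (intro L2_set_coeff_le) auto

lemma coeff_norm_le_sup_norm:
  assumes "compact \<Omega>" "\<Omega> \<noteq> {}" and sol: "exterior_laplace_solution \<Omega> (green_function \<Omega>)"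
    and "degree p \<le> N"
  shows "ennreal (coeff_norm N p) \<le> sup_norm \<Omega> (poly p) * ennreal (rho_star \<Omega> ^ N)"
proof (cases "sup_norm \<Omega> (poly p)")
  case (real M)
  have "coeff_norm N p \<le> M * rho_star \<Omega> ^ N"
    using real by (intro coeff_norm_le assms sup_norm_le_ennrealD) auto
  then show ?thesis
    using real rho_star_ge_1[OF sol] by (simp add: ennreal_mult[symmetric] ennreal_leI)
next
  \<comment> \<open>The right-hand side is infinite too, because \<open>rho_star\<close> is at least
    \<open>1\<close>.\<close>
  case top
  then show ?thesis
    using rho_star_ge_1[OF sol] by (simp add: ennreal_top_mult)
qed

theorem theorem2p4:
  fixes \<Omega> :: "complex set" and F :: "complex \<Rightarrow> complex" and N :: nat
    and Q :: "nat \<Rightarrow> complex poly" and P :: "complex poly"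
    and z :: "nat \<Rightarrow> complex" and \<rho> C :: real
  assumes "compact \<Omega>" and "simply_connected \<Omega>"
    and "\<exists>a\<in>\<Omega>. \<exists>b\<in>\<Omega>. a \<noteq> b"
    and "\<rho> > 1" and "C \<ge> 0"
    and "\<And>n. n \<le> N \<Longrightarrow> degree (Q n) \<le> n"
    and "\<And>n. n \<le> N \<Longrightarrow>
           sup_norm \<Omega> (\<lambda>x. F x - poly (Q n) x) \<le> ennreal (C * \<rho> powi (- int n))"
    and "inj_on z {..N}" and "z ` {..N} \<subseteq> \<Omega>"
    and "interpolates N z F P"
  shows "ennreal (L2_set (\<lambda>k. cmod (coeff P k)) {..N}) \<le>
           sup_norm \<Omega> F +
           ennreal C *
             (lebesgue_constant \<Omega> N z * ennreal ((rho_star \<Omega> / \<rho>) ^ N) +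
              ennreal (2 * rho_star \<Omega> * (\<Sum>j<N. (rho_star \<Omega> / \<rho>) ^ j) + 1))"
proof (cases "sup_norm \<Omega> F")
  case top
  then show ?thesis by simp
next
  case (real A)
  define r where "r = rho_star \<Omega>"
  define \<Lambda> where "\<Lambda> = lebesgue_constant \<Omega> N z"
  have ne: "\<Omega> \<noteq> {}" using assms(3) by auto
  have sol: "exterior_laplace_solution \<Omega> (green_function \<Omega>)"
    using assms(1-3) exterior_laplace_solution_green_function simply_connected_imp_connected by blast
  have r: "r \<ge> 1" unfolding r_def by (rule rho_star_ge_1[OF sol])
  have FQ: "cmod (F x - poly (Q n) x) \<le> C / \<rho> ^ n" if "n \<le> N" "x \<in> \<Omega>" for n x
  proof -
    have "C * \<rho> powi (- int n) = C / \<rho> ^ n"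
      by (simp add: power_int_minus divide_inverse)
    then show ?thesis
      using sup_norm_le_ennrealD[OF assms(7)[OF that(1)] _ that(2)] assms(4,5) by simp
  qed

  \<comment> \<open>\<open>Q 0\<close> is constant, so the exponent is \<open>0\<close> and no
    factor \<open>r\<close> arises.\<close>
  have "coeff_norm N (Q 0) \<le> (A + C) * r ^ 0"
    unfolding r_def
  proof (rule coeff_norm_le[OF assms(1) ne sol])
    fix x assume x: "x \<in> \<Omega>"
    have "cmod (F x) \<le> A"
      by (rule sup_norm_le_ennrealD[OF _ _ x]) (use real in auto)
    moreover have "cmod (poly (Q 0) x) \<le> cmod (F x) + cmod (F x - poly (Q 0) x)"
      using norm_triangle_ineq4[of "F x" "F x - poly (Q 0) x"] by simp
    ultimately show "cmod (poly (Q 0) x) \<le> A + C"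
      using FQ[OF _ x, of 0] by simp
  qed (use assms(6)[of 0] in auto)
  then have Q0: "coeff_norm N (Q 0) \<le> A + C" by simp

  \<comment> \<open>Passing through \<open>F\<close> bounds the difference by twice
    \<open>C / \<rho> ^ j\<close> on \<Omega>. Its degree is at most \<open>j + 1\<close>, one more
    than the power of \<rho>, which leaves the extra factor \<open>r\<close>.\<close>
  have step: "coeff_norm N (Q (Suc j) - Q j) \<le> 2 * C * r * (r / \<rho>) ^ j" if "j < N" for j
  proof -
    have "coeff_norm N (Q (Suc j) - Q j) \<le> (2 * C / \<rho> ^ j) * r ^ Suc j"
      unfolding r_def
    proof (rule coeff_norm_le[OF assms(1) ne sol])
      fix x assume x: "x \<in> \<Omega>"
      have "cmod (poly (Q (Suc j) - Q j) x) = cmod ((F x - poly (Q j) x) - (F x - poly (Q (Suc j)) x))"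
        by simp
      also have "\<dots> \<le> C / \<rho> ^ j + C / \<rho> ^ Suc j"
        using FQ[OF _ x, of j] FQ[OF _ x, of "Suc j"] that
        by (intro order_trans[OF norm_triangle_ineq4[of "F x - poly (Q j) x"]] add_mono) simp_all
      also have "C / \<rho> ^ Suc j \<le> C / \<rho> ^ j"
        using assms(4,5) by (intro divide_left_mono power_increasing) auto
      finally show "cmod (poly (Q (Suc j) - Q j) x) \<le> 2 * C / \<rho> ^ j" by simp
    next
      show "degree (Q (Suc j) - Q j) \<le> Suc j"
        using assms(6)[of j] assms(6)[of "Suc j"] that by (intro degree_diff_le) auto
    qed (use that in auto)
    also have "\<dots> = 2 * C * r * (r / \<rho>) ^ j"
      by (simp add: power_divide)
    finally show ?thesis .
  qed

  \<comment> \<open>\<open>Q N\<close> has degree at most \<open>N\<close>, so subtracting it from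
    \<open>P\<close> gives the interpolant of the remainder, whose node values are at most
    \<open>C / \<rho> ^ N\<close>.\<close>
  have "interpolates N z (\<lambda>x. F x - poly (Q N) x) (P - Q N)"
    using assms(6)[of N] assms(10) by (auto simp: interpolates_def degree_diff_le)
  then have "sup_norm \<Omega> (poly (P - Q N)) \<le> \<Lambda> * ennreal (C / \<rho> ^ N)"
    unfolding \<Lambda>_def using assms(8,9) FQ by (intro sup_norm_interpolant_le) auto
  moreover have "ennreal (coeff_norm N (P - Q N)) \<le> sup_norm \<Omega> (poly (P - Q N)) * ennreal (r ^ N)"
    unfolding r_def using assms(6)[of N] assms(10)
    by (intro coeff_norm_le_sup_norm assms(1) ne sol degree_diff_le) (auto simp: interpolates_def)
  ultimately have "ennreal (coeff_norm N (P - Q N)) \<le> \<Lambda> * ennreal (C / \<rho> ^ N) * ennreal (r ^ N)"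
    by (meson mult_right_mono order_trans zero_le)
  also have "\<dots> = \<Lambda> * ennreal (C / \<rho> ^ N * r ^ N)"
    using assms(4,5) r by (subst ennreal_mult) (auto simp: mult.assoc)
  also have "C / \<rho> ^ N * r ^ N = C * (r / \<rho>) ^ N"
    by (simp add: power_divide)
  finally have PQ: "ennreal (coeff_norm N (P - Q N)) \<le> \<Lambda> * ennreal (C * (r / \<rho>) ^ N)" .

  have P: "Q 0 + (\<Sum>j<N. Q (Suc j) - Q j) + (P - Q N) = P"
    by (simp add: sum_lessThan_telescope)
  have "coeff_norm N P \<le> coeff_norm N (Q 0) + (\<Sum>j<N. coeff_norm N (Q (Suc j) - Q j)) + coeff_norm N (P - Q N)"
    using coeff_norm_triangle[of N "Q 0 + (\<Sum>j<N. Q (Suc j) - Q j)" "P - Q N"]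
      coeff_norm_triangle[of N "Q 0" "\<Sum>j<N. Q (Suc j) - Q j"]
      coeff_norm_sum[of N "\<lambda>j. Q (Suc j) - Q j" "{..<N}"]
    unfolding P by linarith
  also have "(\<Sum>j<N. coeff_norm N (Q (Suc j) - Q j)) \<le> (\<Sum>j<N. 2 * C * r * (r / \<rho>) ^ j)"
    by (intro sum_mono step) simp
  also have "\<dots> = C * (2 * r * (\<Sum>j<N. (r / \<rho>) ^ j))"
    by (simp add: sum_distrib_left mult_ac)
  finally have "coeff_norm N P \<le> A + C * (2 * r * (\<Sum>j<N. (r / \<rho>) ^ j) + 1) + coeff_norm N (P - Q N)"
    using Q0 by (simp add: algebra_simps)
  \<comment> \<open>\<open>ennreal\<close> respects sums and products of nonnegative reals; these
    signs allow the real estimate to be carried over term by term.\<close>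
  moreover have pos: "0 \<le> (\<Sum>j<N. (r / \<rho>) ^ j)" "0 \<le> coeff_norm N (P - Q N)" "A \<ge> 0"
    using r assms(4) real by (auto simp: coeff_norm_def intro!: sum_nonneg)
  ultimately have "ennreal (coeff_norm N P) \<le>
      ennreal A + ennreal C * ennreal (2 * r * (\<Sum>j<N. (r / \<rho>) ^ j) + 1) + ennreal (coeff_norm N (P - Q N))"
    using assms(5) r by (simp add: ennreal_plus[symmetric] ennreal_mult[symmetric] ennreal_leI del: ennreal_plus)
  also have "\<dots> \<le> ennreal A + ennreal C * ennreal (2 * r * (\<Sum>j<N. (r / \<rho>) ^ j) + 1) + \<Lambda> * ennreal (C * (r / \<rho>) ^ N)"
    by (intro add_left_mono PQ)
  also have "\<Lambda> * ennreal (C * (r / \<rho>) ^ N) = ennreal C * (\<Lambda> * ennreal ((r / \<rho>) ^ N))"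
    using assms(4,5) r by (simp add: ennreal_mult mult.left_commute)
  finally show ?thesis
    using real unfolding r_def \<Lambda>_def coeff_norm_def
    by (simp add: distrib_left add_ac)
qed

end
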